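(* Let $\Gamma=(\Gamma_n)_n$ be a sequence of graphs and consider testing $\mathcal H_0:\mathsf G\sim\mathcal G(n,q_n)$ versus $\mathcal H_1:\mathsf G\sim\mathcal G_{\Gamma_n}(n,p_n,q_n)$ in the dense regime $\chi^2(p_n\|q_n)=\Theta(1)$. Suppose $\mu(\Gamma_n)=\Omega(\log|v(\Gamma_n)|)$. Then, assuming the low-degree polynomial conjecture, for every $\varepsilon>0$ strong detection in polynomial time is impossible (no polynomial-time computable sequence of tests achieves strong detection) whenever $$|e(\Gamma_n)|\vee d_{\max}^2(\Gamma_n)\le n^{1-\varepsilon}.$$
   Context: For each $n$, $\Gamma_n$ is an arbitrary finite simple undirected graph without isolated vertices, with vertex set $v(\Gamma_n)$, edge set $e(\Gamma_n)$ and $|v(\Gamma_n)|\le n$. $\mathcal S_{\Gamma_n}$ is the set of subgraphs of the complete graph $\mathcal K_n$ on $[n]$ isomorphic to $\Gamma_n$. $0<q_n<1$, $q_n<p_n\le1$. $\mathcal G_{\Gamma_n}(n,p_n,q_n)$: draw a uniformly random copy from $\mathcal S_{\Gamma_n}$; conditionally on it, include every edge of $\mathcal K_n$ independently, with probability $p_n$ if it belongs to the copy and $q_n$ otherwise. The risk of a test $\phi_n(\mathsf G)\in\{0,1\}$ is $\mathsf R_n(\phi_n)=\mathbb P_{\mathcal H_0}(\phi_n=1)+\mathbb P_{\mathcal H_1}(\phi_n=0)$; a sequence of tests achieves strong detection if $\limsup_n\mathsf R_n(\phi_n)=0$. $\chi^2(p\|q)=\frac{(p-q)^2}{q(1-q)}$;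 $d_{\max}$ is the maximum degree; $\mu(\mathsf G)=\max\{|e(\mathsf H)|/|v(\mathsf H)|:\emptyset\ne\mathsf H\subseteq\mathsf G\}$. Let $\mathsf L_n=d\mathbb P_{\mathcal H_1}/d\mathbb P_{\mathcal H_0}$, $\langle f,g\rangle_{\mathcal H_0}=\mathbb E_{\mathcal H_0}[f(\mathsf G)g(\mathsf G)]$ and $\|f\|_{\mathcal H_0}=\langle f,f\rangle_{\mathcal H_0}^{1/2}$. $\mathsf L_{n,\le\mathsf D}$ is the orthogonal projection of $\mathsf L_n$, w.r.t. this inner product, onto the space of polynomials of degree at most $\mathsf D$ in the edge indicators of $\mathsf G$. Low-degree polynomial conjecture: for a sequence of pairs $(\mathbb P_{\mathcal H_0},\mathbb P_{\mathcal H_1})$, if there exist $\epsilon>0$ and $\mathsf D=\mathsf D(n)\ge(\log n)^{1+\epsilon}$ such that $\|\mathsf L_{n,\le\mathsf D}\|_{\mathcal H_0}$ remains bounded as $n\to\infty$, then there is no polynomial-time algorithm that distinguishes $\mathbb P_{\mathcal H_0}$ and $\mathbb P_{\mathcal H_1}$ (achieves strong detection). *)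

theory Defs
  imports
    "HOL-Probability.Probability"
    "HOL-Library.Ramsey"
    "HOL-Library.Landau_Symbols"
begin

section \<open>Graphs\<close>

record 'a ugraph =
  verts :: "'a set"
  edges :: "'a set set"

text \<open>\<open>[V]\<^bsup>2\<^esup>\<close> is the set of two-element subsets of \<open>V\<close>.\<close>

definition simple_graph :: "'a ugraph \<Rightarrow> bool" where
  "simple_graph G \<longleftrightarrow> finite (verts G) \<and> edges G \<subseteq> [verts G]\<^bsup>2\<^esup>"

definition no_isolated_vertices :: "'a ugraph \<Rightarrow> bool" where
  "no_isolated_vertices G \<longleftrightarrow> (\<forall>v\<in>verts G. \<exists>e\<in>edges G. v \<in> e)"

definition subgraph :: "'a ugraph \<Rightarrow> 'a ugraph \<Rightarrow> bool" where
  "subgraph H G \<longleftrightarrow> simple_graph H \<and> verts H \<subseteq> verts G \<and> edges H \<subseteq> edges G"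

definition isomorphic :: "'a ugraph \<Rightarrow> 'b ugraph \<Rightarrow> bool" where
  "isomorphic G H \<longleftrightarrow> (\<exists>f. bij_betw f (verts G) (verts H) \<and> (`) f ` edges G = edges H)"

text \<open>The null graph (no vertices) is allowed; the inserted \<open>0\<close> gives it maximum degree and
  maximal density \<open>0\<close>, and changes neither quantity for any other graph.\<close>

definition max_degree :: "'a ugraph \<Rightarrow> nat" where
  "max_degree G = Max (insert 0 ((\<lambda>v. card {e \<in> edges G. v \<in> e}) ` verts G))"

definition max_density :: "'a ugraph \<Rightarrow> real" where
  "max_density G = Max (insert 0
     {real (card (edges H)) / real (card (verts H)) | H. subgraph H G \<and> verts H \<noteq> {}})"

definition complete_ugraph :: "nat \<Rightarrow> nat ugraph" where
  "complete_ugraph n = \<lparr>verts = {1..n}, edges = [{1..n}]\<^bsup>2\<^esup>\<rparr>"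

definition copies :: "nat \<Rightarrow> 'a ugraph \<Rightarrow> nat ugraph set" where
  "copies n \<Gamma> = {H. subgraph H (complete_ugraph n) \<and> isomorphic \<Gamma> H}"

section \<open>The two hypotheses\<close>

text \<open>The observed graph has vertex set \<open>{1..n}\<close> and is represented by its edge set.
  \<open>independent_edges n w\<close> includes each edge \<open>e\<close> of the complete graph independently
  with probability \<open>w e\<close>.\<close>

definition independent_edges :: "nat \<Rightarrow> (nat set \<Rightarrow> real) \<Rightarrow> nat set set pmf" where
  "independent_edges n w =
     map_pmf (\<lambda>b. {e \<in> edges (complete_ugraph n). b e})
       (Pi_pmf (edges (complete_ugraph n)) False (\<lambda>e. bernoulli_pmf (w e)))"

definition erdos_renyi :: "nat \<Rightarrow> real \<Rightarrow> nat set set pmf" where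
  "erdos_renyi n q = independent_edges n (\<lambda>_. q)"

definition planted_graph :: "'a ugraph \<Rightarrow> nat \<Rightarrow> real \<Rightarrow> real \<Rightarrow> nat set set pmf" where
  "planted_graph \<Gamma> n p q =
     bind_pmf (pmf_of_set (copies n \<Gamma>))
       (\<lambda>H. independent_edges n (\<lambda>e. if e \<in> edges H then p else q))"

definition chi_square :: "real \<Rightarrow> real \<Rightarrow> real" where
  "chi_square p q = (p - q)\<^sup>2 / (q * (1 - q))"

section \<open>Tests and strong detection\<close>

text \<open>A test is a sequence of decision functions; \<open>True\<close> stands for the outcome \<open>1\<close>,
  i.e. for rejecting the null hypothesis.\<close>

definition risk :: "'g pmf \<Rightarrow> 'g pmf \<Rightarrow> ('g \<Rightarrow> bool) \<Rightarrow> real" where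
  "risk P0 P1 \<phi> = measure_pmf.prob P0 {G. \<phi> G} + measure_pmf.prob P1 {G. \<not> \<phi> G}"

definition strong_detection ::
    "(nat \<Rightarrow> 'g pmf) \<Rightarrow> (nat \<Rightarrow> 'g pmf) \<Rightarrow> (nat \<Rightarrow> 'g \<Rightarrow> bool) \<Rightarrow> bool" where
  "strong_detection P0 P1 \<phi> \<longleftrightarrow>
     limsup (\<lambda>n. ereal (risk (P0 n) (P1 n) (\<phi> n))) = 0"

section \<open>Polynomial-time computable tests\<close>

text \<open>Deterministic single-tape Turing machines with states \<open>{..<n_states}\<close>, tape symbols
  \<open>{..<n_symbols}\<close> (symbol \<open>0\<close> is the blank) and a two-way infinite tape.\<close>

datatype move = MoveLeft | MoveRight | Stay

fun offset :: "move \<Rightarrow> int" where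
  "offset MoveLeft = -1"
| "offset MoveRight = 1"
| "offset Stay = 0"

record turing_machine =
  n_states :: nat
  n_symbols :: nat
  start :: nat
  accept :: nat
  reject :: nat
  transition :: "nat \<Rightarrow> nat \<Rightarrow> nat \<times> nat \<times> move"

text \<open>At least four symbols are required, since inputs are written with the symbols
  \<open>1\<close>, \<open>2\<close>, \<open>3\<close>.\<close>

definition wf_turing_machine :: "turing_machine \<Rightarrow> bool" where
  "wf_turing_machine M \<longleftrightarrow>
     4 \<le> n_symbols M \<and>
     start M < n_states M \<and> accept M < n_states M \<and> reject M < n_states M \<and>
     accept M \<noteq> reject M \<and>
     (\<forall>s < n_states M. \<forall>a < n_symbols M.
        case transition M s a of (s', a', _) \<Rightarrow> s' < n_states M \<and> a' < n_symbols M)"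

record config =
  state :: nat
  tape :: "int \<Rightarrow> nat"
  head :: int

definition step :: "turing_machine \<Rightarrow> config \<Rightarrow> config" where
  "step M c =
     (if state c = accept M \<or> state c = reject M then c
      else case transition M (state c) (tape c (head c)) of (s', a', m) \<Rightarrow>
        \<lparr>state = s', tape = (tape c)(head c := a'), head = head c + offset m\<rparr>)"

definition initial_config :: "turing_machine \<Rightarrow> nat list \<Rightarrow> config" where
  "initial_config M xs =
     \<lparr>state = start M,
      tape = (\<lambda>i. if 0 \<le> i \<and> nat i < length xs then xs ! nat i else 0),
      head = 0\<rparr>"

definition state_after :: "turing_machine \<Rightarrow> nat list \<Rightarrow> nat \<Rightarrow> nat" where
  "state_after M xs t = state ((step M ^^ t) (initial_config M xs))"

text \<open>A graph on \<open>{1..n}\<close> is written as its adjacency matrix, row by row: \<open>1\<close> codes a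
  non-edge, \<open>2\<close> an edge, and \<open>3\<close> ends a row. The word has length \<open>n * (n + 1)\<close>, so it
  determines \<open>n\<close>, and polynomial in its length means polynomial in \<open>n\<close>.\<close>

definition encode_graph :: "nat \<Rightarrow> nat set set \<Rightarrow> nat list" where
  "encode_graph n G =
     concat (map (\<lambda>i. map (\<lambda>j. if {i, j} \<in> G then 2 else 1) [1..<Suc n] @ [3]) [1..<Suc n])"

text \<open>One machine has to work for all \<open>n\<close>.\<close>

definition polytime_test :: "(nat \<Rightarrow> nat set set \<Rightarrow> bool) \<Rightarrow> bool" where
  "polytime_test \<phi> \<longleftrightarrow>
     (\<exists>M c k. wf_turing_machine M \<and>
        (\<forall>n. \<forall>G \<subseteq> edges (complete_ugraph n). \<exists>t \<le> c * n ^ k + c.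
           state_after M (encode_graph n G) t = (if \<phi> n G then accept M else reject M)))"

section \<open>Low-degree polynomials\<close>

text \<open>Monomials in the edge indicators are indexed by multisets of edges, the multiplicity of an
  edge being its exponent.\<close>

definition monomials :: "nat \<Rightarrow> nat \<Rightarrow> nat set multiset set" where
  "monomials n D = {m. set_mset m \<subseteq> edges (complete_ugraph n) \<and> size m \<le> D}"

lemma finite_monomials: "finite (monomials n D)"
proof -
  have "finite (edges (complete_ugraph n))"
    by (simp add: complete_ugraph_def finite_imp_finite_nsets)
  then have "finite (\<Union>d\<le>D. multisets_of_size (edges (complete_ugraph n)) d)"
    by auto
  then show ?thesis
    by (rule rev_finite_subset) (auto simp: monomials_def multisets_of_size_def)
qed

definition low_degree_polynomials :: "nat \<Rightarrow> nat \<Rightarrow> (nat set set \<Rightarrow> real) set" where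
  "low_degree_polynomials n D =
     {f. \<exists>a. f = (\<lambda>G. \<Sum>m\<in>monomials n D. a m * (\<Prod>e\<in>#m. of_bool (e \<in> G)))}"

definition inner_pmf :: "'g pmf \<Rightarrow> ('g \<Rightarrow> real) \<Rightarrow> ('g \<Rightarrow> real) \<Rightarrow> real" where
  "inner_pmf P f g = measure_pmf.expectation P (\<lambda>G. f G * g G)"

definition norm_pmf :: "'g pmf \<Rightarrow> ('g \<Rightarrow> real) \<Rightarrow> real" where
  "norm_pmf P f = sqrt (inner_pmf P f f)"

text \<open>Orthogonal projections are unique up to null sets, so the choice does not affect norms.\<close>

definition orthogonal_projection ::
    "'g pmf \<Rightarrow> ('g \<Rightarrow> real) set \<Rightarrow> ('g \<Rightarrow> real) \<Rightarrow> 'g \<Rightarrow> real" where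
  "orthogonal_projection P V f =
     (SOME g. g \<in> V \<and> (\<forall>h\<in>V. inner_pmf P (\<lambda>G. f G - g G) h = 0))"

definition likelihood_ratio :: "'g pmf \<Rightarrow> 'g pmf \<Rightarrow> 'g \<Rightarrow> real" where
  "likelihood_ratio P0 P1 G = enn2real (RN_deriv (measure_pmf P0) (measure_pmf P1) G)"

definition low_degree_likelihood_ratio ::
    "nat \<Rightarrow> nat set set pmf \<Rightarrow> nat set set pmf \<Rightarrow> nat \<Rightarrow> nat set set \<Rightarrow> real" where
  "low_degree_likelihood_ratio n P0 P1 D =
     orthogonal_projection P0 (low_degree_polynomials n D) (likelihood_ratio P0 P1)"

text \<open>The conjecture is a property of a given sequence of pairs of distributions of graphs on
  \<open>{1..n}\<close>. It presupposes that the likelihood ratios exist. Quantified over arbitrary pairs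
  it would be refutable (take the uniform distribution against the uniform distribution on
  graphs with all degrees even), so it is not to be assumed in that form.\<close>

definition low_degree_conjecture ::
    "(nat \<Rightarrow> nat set set pmf) \<Rightarrow> (nat \<Rightarrow> nat set set pmf) \<Rightarrow> bool" where
  "low_degree_conjecture P0 P1 \<longleftrightarrow>
     ((\<forall>n. absolutely_continuous (measure_pmf (P0 n)) (measure_pmf (P1 n))) \<and>
      (\<exists>\<epsilon>>0. \<exists>D :: nat \<Rightarrow> nat.
         (\<forall>n. ln (real n) powr (1 + \<epsilon>) \<le> real (D n)) \<and>
         Bseq (\<lambda>n. norm_pmf (P0 n) (low_degree_likelihood_ratio n (P0 n) (P1 n) (D n))))
      \<longrightarrow> \<not> (\<exists>\<phi>. polytime_test \<phi> \<and> strong_detection P0 P1 \<phi>))"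

end

theory Submission
  imports Defs "HOL-Real_Asymp.Real_Asymp"
begin

text \<open>In the Fourier basis \<open>chi q S\<close>, indexed by the edge sets \<open>S\<close>, the squared norm of the degree-\<open>D\<close>
  likelihood ratio is the sum over \<open>card S \<le> D\<close> of \<open>\<chi>\<^sup>2\<close> to the power \<open>card S\<close> times the square of
  \<open>P(S \<subseteq> H)\<close>, where \<open>H\<close> is the random copy. Averaging over permutations of the vertices, for \<open>v\<close>
  vertices covered by \<open>S\<close>, \<open>P(S \<subseteq> H)\<close> is at most \<open>(n - v)! / n!\<close> times the number of homomorphisms
  from \<open>S\<close>, and that number is at most \<open>R^v\<close> as soon as the maximum degree is at most \<open>R\<close> and twice
  the number of edges at most \<open>R\<^sup>2\<close>. With \<open>R\<^sup>2 = 2 n powr (1 - \<epsilon>)\<close> every vertex of \<open>S\<close> contributes a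
  factor \<open>8 n powr (-1 - \<epsilon>)\<close>. For \<open>D\<close> of order \<open>(ln n) powr (3/2)\<close>, the weighted number of graphs with
  at most \<open>D\<close> edges on \<open>v\<close> given vertices is at most \<open>n powr (\<epsilon> v / 2)\<close>, so that the sum is at most
  \<open>(1 + 8 n powr (-1 - \<epsilon> / 2)) ^ n\<close>, which is bounded.\<close>

section \<open>Counting homomorphisms\<close>

text \<open>When \<open>S\<close> consists of two-element subsets of \<open>V\<close>, these are the
  homomorphisms from the graph \<open>(V, S)\<close> to \<open>G\<close>. Extensionality outside
  \<open>V\<close> makes them a finite set that can be counted.\<close>

definition edge_maps :: "'b set \<Rightarrow> 'b set set \<Rightarrow> 'a ugraph \<Rightarrow> ('b \<Rightarrow> 'a) set" where
  "edge_maps V S G = {\<phi> \<in> V \<rightarrow>\<^sub>E verts G. \<forall>e\<in>S. \<phi> ` e \<in> edges G}"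

lemma finite_edges: "simple_graph G \<Longrightarrow> finite (edges G)"
  unfolding simple_graph_def by (meson finite_imp_finite_nsets finite_subset)

lemma finite_edge_maps: "finite V \<Longrightarrow> simple_graph G \<Longrightarrow> finite (edge_maps V S G)"
  unfolding edge_maps_def simple_graph_def
  by (rule finite_subset[of _ "V \<rightarrow>\<^sub>E verts G"]) (auto intro: finite_PiE)

lemma edge_verts: "simple_graph G \<Longrightarrow> {x, y} \<in> edges G \<Longrightarrow> x \<in> verts G \<and> y \<in> verts G \<and> x \<noteq> y"
  unfolding simple_graph_def by (metis doubleton_in_nsets_2 subsetD)

lemma degree_le_max_degree:
  assumes "simple_graph G" "v \<in> verts G"
  shows "card {e \<in> edges G. v \<in> e} \<le> max_degree G"
  using assms unfolding max_degree_def simple_graph_def by (intro Max_ge) auto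

lemma card_neighbours_le:
  assumes G: "simple_graph G"
  shows "card {x. {x, y} \<in> edges G} \<le> max_degree G"
proof (cases "y \<in> verts G")
  case True
  have "card {x. {x, y} \<in> edges G} \<le> card {e \<in> edges G. y \<in> e}"
    by (rule card_inj_on_le[where f = "\<lambda>x. {x, y}"])
      (use finite_edges[OF G] in \<open>auto simp: inj_on_def doubleton_eq_iff\<close>)
  then show ?thesis
    using degree_le_max_degree[OF G True] by simp
next
  case False
  then have "{x. {x, y} \<in> edges G} = {}"
    using edge_verts[OF G] by blast
  then show ?thesis by simp
qed

text \<open>Each edge can be ordered in two ways. This is the number of possible images of an edge
  whose two endpoints are placed at once.\<close>

lemma card_directed_edges_le:
  assumes G: "simple_graph G"
  shows "finite {(x, y). {x, y} \<in> edges G} \<and> card {(x, y). {x, y} \<in> edges G} \<le> 2 * card (edges G)"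
proof -
  have eq: "{(x, y). {x, y} \<in> edges G} = (\<Union>e\<in>edges G. {(x, y). {x, y} = e})" by auto
  have *: "finite {(x, y). {x, y} = e} \<and> card {(x, y). {x, y} = e} \<le> 2" if e: "e \<in> edges G" for e
  proof -
    have "e \<in> [verts G]\<^bsup>2\<^esup>" using e G unfolding simple_graph_def by blast
    then obtain a b where ab: "e = {a, b}" by (auto simp: nsets_def card_2_iff)
    have *: "{(x, y). {x, y} = e} = {(a, b), (b, a)}" by (auto simp: ab doubleton_eq_iff)
    show ?thesis unfolding * using card_insert_le_m1[of 2 "{(b, a)}" "(a, b)"] by simp
  qed
  have "card (\<Union>e\<in>edges G. {(x, y). {x, y} = e}) \<le> (\<Sum>e\<in>edges G. card {(x, y). {x, y} = e})"
    by (rule card_UN_le[OF finite_edges[OF G]])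
  also have "\<dots> \<le> (\<Sum>e\<in>edges G. 2)" by (intro sum_mono) (use * in auto)
  finally have "card (\<Union>e\<in>edges G. {(x, y). {x, y} = e}) \<le> 2 * card (edges G)" by simp
  moreover have "finite (\<Union>e\<in>edges G. {(x, y). {x, y} = e})"
    by (rule finite_UN_I[OF finite_edges[OF G]]) (use * in blast)
  ultimately show ?thesis unfolding eq by (rule conjI[rotated])
qed

text \<open>This is the peeling step for counting homomorphisms: what remains is again covered by
  its edges. If no single vertex can be deleted without uncovering another, some edge is a connected
  component by itself, and both its endpoints can go.\<close>

lemma removable_vertex_or_edge:
  assumes "S \<subseteq> [V]\<^bsup>2\<^esup>" "\<Union>S = V" "V \<noteq> {}"
  obtains (vertex) u w where "{u, w} \<in> S" "u \<in> V" "w \<in> V" "u \<noteq> w" "\<Union>{e \<in> S. u \<notin> e} = V - {u}"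
  | (edge) u w where "{u, w} \<in> S" "u \<in> V" "w \<in> V" "u \<noteq> w"
      "\<Union>{e \<in> S. u \<notin> e \<and> w \<notin> e} = V - {u, w}"
proof (cases "\<exists>u\<in>V. \<Union>{e \<in> S. u \<notin> e} = V - {u}")
  case True
  then obtain u where u: "u \<in> V" "\<Union>{e \<in> S. u \<notin> e} = V - {u}" by blast
  then obtain e where e: "e \<in> S" "u \<in> e" using assms(2) by blast
  then obtain w where w: "e = {u, w}" "w \<in> V" "u \<noteq> w"
    using assms(1) by (auto simp: nsets_def card_2_iff)
  show thesis using vertex e u w by blast
next
  case False
  \<comment> \<open>Deleting \<open>u\<close> uncovers some other vertex \<open>w\<close>, so every
    edge at \<open>w\<close> also contains \<open>u\<close>.\<close>
  have only: "\<exists>w\<in>V. w \<noteq> u \<and> (\<forall>e\<in>S. w \<in> e \<longrightarrow> e = {u, w})" if "u \<in> V" for u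
  proof -
    have "\<Union>{e \<in> S. u \<notin> e} \<subseteq> V - {u}" using assms(2) by auto
    moreover have "\<Union>{e \<in> S. u \<notin> e} \<noteq> V - {u}" using False that by simp
    ultimately obtain w where w: "w \<in> V - {u}" "w \<notin> \<Union>{e \<in> S. u \<notin> e}" by auto
    have "e = {u, w}" if e: "e \<in> S" "w \<in> e" for e
    proof -
      have "u \<in> e" using w(2) e by auto
      moreover obtain a b where "e = {a, b}" using e(1) assms(1) by (auto simp: nsets_def card_2_iff)
      ultimately show ?thesis using w(1) e(2) by auto
    qed
    then show ?thesis using w(1) by auto
  qed
  obtain u where u: "u \<in> V" using assms(3) by blast
  obtain w where w: "w \<in> V" "w \<noteq> u" and wu: "\<And>e. e \<in> S \<Longrightarrow> w \<in> e \<Longrightarrow> e = {u, w}"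
    using only[OF u] by blast
  \<comment> \<open>The same fact at \<open>w\<close> gives a vertex \<open>x\<close> whose only
    edge is \<open>{w, x}\<close>. As the only edge at \<open>w\<close> is \<open>{u, w}\<close>,
    this forces \<open>x = u\<close>, so \<open>{u, w}\<close> is isolated.\<close>
  obtain x where x: "x \<in> V" "x \<noteq> w" and xw: "\<And>e. e \<in> S \<Longrightarrow> x \<in> e \<Longrightarrow> e = {w, x}"
    using only[OF w(1)] by blast
  have "x = u"
  proof -
    obtain e where e: "e \<in> S" "x \<in> e" using x assms(2) by blast
    then have "e = {w, x}" by (rule xw)
    then have "e = {u, w}" using wu[OF e(1)] by simp
    then show ?thesis using e(2) x(2) by simp
  qed
  then have uw: "e = {u, w}" if "e \<in> S" "u \<in> e" for e
    using xw[of e] that by (simp add: insert_commute)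
  have "{u, w} \<in> S" using assms(2) u uw by (metis UnionE)
  moreover have "\<Union>{e \<in> S. u \<notin> e \<and> w \<notin> e} = V - {u, w}"
  proof (intro equalityI subsetI)
    fix z assume z: "z \<in> V - {u, w}"
    then obtain e where e: "e \<in> S" "z \<in> e" using assms(2) by auto
    then have "u \<notin> e" "w \<notin> e" using uw[OF e(1)] wu[OF e(1)] z by auto
    then show "z \<in> \<Union>{e \<in> S. u \<notin> e \<and> w \<notin> e}" using e by auto
  qed (use assms(2) in auto)
  ultimately show thesis using edge u w by blast
qed

text \<open>Induction along the peeling: a removed vertex with a remaining neighbour has at most
  \<open>max_degree G\<close>, hence at most \<open>R\<close>, images once the rest is placed. A
  removed isolated edge has at most \<open>2 * card (edges G)\<close>, hence at most
  \<open>R\<^sup>2\<close>, ordered images. Either way each vertex costs one factor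
  \<open>R\<close>; strong induction is used because one or two vertices disappear.\<close>

lemma card_edge_maps_le:
  assumes G: "simple_graph G"
    and deg: "real (max_degree G) \<le> R" and edg: "2 * real (card (edges G)) \<le> R\<^sup>2"
    and "finite V" "S \<subseteq> [V]\<^bsup>2\<^esup>" "\<Union>S = V"
  shows "real (card (edge_maps V S G)) \<le> R ^ card V"
  using assms(4-6)
proof (induction "card V" arbitrary: V S rule: less_induct)
  case less
  have R: "0 \<le> R" using deg by linarith
  show ?case
  proof (cases "V = {}")
    case True
    then have "S = {}" using less.prems by (auto simp: nsets_def)
    then show ?thesis using True by (simp add: edge_maps_def)
  next
    case False
    show ?thesis
      using less.prems(2,3) False
    proof (cases rule: removable_vertex_or_edge)
      case (vertex u w)
      define V' where "V' = V - {u}"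
      define S' where "S' = {e \<in> S. u \<notin> e}"
      have S': "S' \<subseteq> [V']\<^bsup>2\<^esup>" using less.prems(2) by (auto simp: S'_def V'_def nsets_def)
      have fV': "finite V'" using less.prems(1) by (simp add: V'_def)
      have cV: "card V = Suc (card V')"
        unfolding V'_def by (rule card_Suc_Diff1[OF less.prems(1) vertex(2), symmetric])
      \<comment> \<open>A map is recovered from its restriction to \<open>V'\<close> and its value
        at \<open>u\<close>, which must be adjacent to the value at \<open>w\<close>.\<close>
      have "card (edge_maps V S G) \<le> card (SIGMA \<psi>:edge_maps V' S' G. {x. {x, \<psi> w} \<in> edges G})"
      proof (rule card_inj_on_le)
        show "inj_on (\<lambda>\<phi>. (restrict \<phi> V', \<phi> u)) (edge_maps V S G)"
        proof (rule inj_onI)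
          fix f g assume fg: "f \<in> edge_maps V S G" "g \<in> edge_maps V S G"
            and eq: "(restrict f V', f u) = (restrict g V', g u)"
          have "f x = g x" if "x \<in> V" for x
            using eq that unfolding V'_def by (cases "x = u") (auto dest: fun_cong[where x = x])
          then show "f = g" using fg unfolding edge_maps_def by (auto intro: PiE_ext)
        qed
        show "(\<lambda>\<phi>. (restrict \<phi> V', \<phi> u)) ` edge_maps V S G
            \<subseteq> (SIGMA \<psi>:edge_maps V' S' G. {x. {x, \<psi> w} \<in> edges G})"
        proof (rule image_subsetI)
          fix f assume f: "f \<in> edge_maps V S G"
          have "restrict f V' ` e = f ` e" if "e \<in> S'" for e
            using that S' by (intro image_cong refl) (auto simp: nsets_def)
          then have "restrict f V' \<in> edge_maps V' S' G"
            using f unfolding edge_maps_def by (auto simp: V'_def S'_def)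
          moreover have "f ` {u, w} \<in> edges G" using f vertex(1) unfolding edge_maps_def by blast
          then have "{f u, restrict f V' w} \<in> edges G" using vertex by (simp add: V'_def)
          ultimately show "(restrict f V', f u) \<in> (SIGMA \<psi>:edge_maps V' S' G. {x. {x, \<psi> w} \<in> edges G})"
            by simp
        qed
        show "finite (SIGMA \<psi>:edge_maps V' S' G. {x. {x, \<psi> w} \<in> edges G})"
        proof (intro finite_SigmaI finite_edge_maps fV' G)
          fix \<psi> show "finite {x. {x, \<psi> w} \<in> edges G}"
            using edge_verts[OF G] G unfolding simple_graph_def
            by (auto intro: finite_subset[of _ "verts G"])
        qed
      qed
      also have "\<dots> = (\<Sum>\<psi>\<in>edge_maps V' S' G. card {x. {x, \<psi> w} \<in> edges G})"
        using edge_verts[OF G] G unfolding simple_graph_def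
        by (intro card_SigmaI finite_edge_maps[OF fV' G]) (auto intro!: finite_subset[of _ "verts G"])
      also have "\<dots> \<le> card (edge_maps V' S' G) * max_degree G"
        using sum_bounded_above[of "edge_maps V' S' G" _ "max_degree G"] card_neighbours_le[OF G] by simp
      finally have "real (card (edge_maps V S G)) \<le> real (card (edge_maps V' S' G)) * real (max_degree G)"
        by (simp only: of_nat_le_iff flip: of_nat_mult)
      also have "\<dots> \<le> R ^ card V' * R"
        using less.hyps[of V' S'] cV fV' S' vertex(5) deg R
        by (intro mult_mono) (auto simp: V'_def S'_def)
      finally show ?thesis by (simp add: cV mult.commute)
    next
      case (edge u w)
      define V' where "V' = V - {u, w}"
      define S' where "S' = {e \<in> S. u \<notin> e \<and> w \<notin> e}"
      define P where "P = {(x, y). {x, y} \<in> edges G}"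
      have P: "finite P" "card P \<le> 2 * card (edges G)"
        using card_directed_edges_le[OF G] by (auto simp: P_def)
      have S': "S' \<subseteq> [V']\<^bsup>2\<^esup>" using less.prems(2) by (auto simp: S'_def V'_def nsets_def)
      have "V = insert u (insert w V')" and "u \<notin> insert w V'" "w \<notin> V'"
        using edge by (auto simp: V'_def)
      moreover have fV': "finite V'" using less.prems(1) by (simp add: V'_def)
      ultimately have cV: "card V = Suc (Suc (card V'))"
        by (simp only: card_insert_disjoint finite_insert not_False_eq_True)
      \<comment> \<open>Here the restriction to \<open>V'\<close> is paired with the ordered image
        of the isolated edge.\<close>
      have "card (edge_maps V S G) \<le> card (edge_maps V' S' G \<times> P)"
      proof (rule card_inj_on_le)
        show "inj_on (\<lambda>\<phi>. (restrict \<phi> V', \<phi> u, \<phi> w)) (edge_maps V S G)"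
        proof (rule inj_onI)
          fix f g assume fg: "f \<in> edge_maps V S G" "g \<in> edge_maps V S G"
            and eq: "(restrict f V', f u, f w) = (restrict g V', g u, g w)"
          have "f x = g x" if "x \<in> V" for x
            using eq that unfolding V'_def
            by (cases "x = u"; cases "x = w") (auto dest: fun_cong[where x = x])
          then show "f = g" using fg unfolding edge_maps_def by (auto intro: PiE_ext)
        qed
        show "(\<lambda>\<phi>. (restrict \<phi> V', \<phi> u, \<phi> w)) ` edge_maps V S G \<subseteq> edge_maps V' S' G \<times> P"
        proof (rule image_subsetI)
          fix f assume f: "f \<in> edge_maps V S G"
          have "restrict f V' ` e = f ` e" if "e \<in> S'" for e
            using that S' by (intro image_cong refl) (auto simp: nsets_def)
          then have "restrict f V' \<in> edge_maps V' S' G"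
            using f unfolding edge_maps_def by (auto simp: V'_def S'_def)
          moreover have "f ` {u, w} \<in> edges G" using f edge(1) unfolding edge_maps_def by blast
          then have "(f u, f w) \<in> P" by (simp add: P_def)
          ultimately show "(restrict f V', f u, f w) \<in> edge_maps V' S' G \<times> P" by simp
        qed
        show "finite (edge_maps V' S' G \<times> P)"
          by (intro finite_cartesian_product finite_edge_maps fV' G P)
      qed
      then have "real (card (edge_maps V S G)) \<le> real (card (edge_maps V' S' G)) * real (card P)"
        by (simp only: of_nat_le_iff card_cartesian_product flip: of_nat_mult)
      also have "\<dots> \<le> R ^ card V' * R\<^sup>2"
      proof (intro mult_mono)
        show "real (card P) \<le> R\<^sup>2" using P(2) edg by linarith
      qed (use less.hyps[of V' S'] cV fV' S' edge(5) R in \<open>auto simp: V'_def S'_def\<close>)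
      finally show ?thesis by (simp add: cV power2_eq_square mult_ac)
    qed
  qed
qed

section \<open>The probability that a random copy contains a given edge set\<close>

lemma finite_copies: "finite (copies n \<Gamma>)"
proof (rule finite_subset)
  show "copies n \<Gamma> \<subseteq> (\<lambda>(V, E). \<lparr>verts = V, edges = E\<rparr>) ` (Pow {1..n} \<times> Pow (Pow {1..n}))"
  proof
    fix H :: "nat ugraph" assume H: "H \<in> copies n \<Gamma>"
    have "(verts H, edges H) \<in> Pow {1..n} \<times> Pow (Pow {1..n})"
      using H by (auto simp: copies_def subgraph_def complete_ugraph_def nsets_def)
    moreover have "H = (\<lambda>(V, E). \<lparr>verts = V, edges = E\<rparr>) (verts H, edges H)" by simp
    ultimately show "H \<in> (\<lambda>(V, E). \<lparr>verts = V, edges = E\<rparr>) ` (Pow {1..n} \<times> Pow (Pow {1..n}))"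
      by blast
  qed
qed auto

section \<open>Transport of graphs along injections and isomorphisms\<close>

definition map_ugraph :: "('a \<Rightarrow> 'b) \<Rightarrow> 'a ugraph \<Rightarrow> 'b ugraph" where
  "map_ugraph f G = \<lparr>verts = f ` verts G, edges = (`) f ` edges G\<rparr>"

lemma isomorphic_map_ugraph: "inj_on f (verts G) \<Longrightarrow> isomorphic G (map_ugraph f G)"
  unfolding isomorphic_def map_ugraph_def by (auto simp: bij_betw_def)

lemma simple_map_ugraph:
  assumes "inj_on f (verts G)" "simple_graph G"
  shows "simple_graph (map_ugraph f G)"
  unfolding simple_graph_def map_ugraph_def ugraph.simps
proof (intro conjI subsetI)
  show "finite (f ` verts G)" using assms(2) by (simp add: simple_graph_def)
  fix e assume "e \<in> (`) f ` edges G"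
  then obtain d where d: "d \<in> edges G" "e = f ` d" by blast
  then have "d \<in> [verts G]\<^bsup>2\<^esup>" using assms(2) by (auto simp: simple_graph_def)
  then show "e \<in> [f ` verts G]\<^bsup>2\<^esup>"
    using assms(1) d by (auto simp: nsets_def card_image inj_on_subset)
qed

lemma isomorphic_trans:
  assumes "isomorphic G H" "isomorphic H K"
  shows "isomorphic G K"
proof -
  obtain f where f: "bij_betw f (verts G) (verts H)" "(`) f ` edges G = edges H"
    using assms(1) unfolding isomorphic_def by blast
  obtain g where g: "bij_betw g (verts H) (verts K)" "(`) g ` edges H = edges K"
    using assms(2) unfolding isomorphic_def by blast
  have "(`) (g \<circ> f) ` edges G = edges K"
    unfolding g(2)[symmetric] f(2)[symmetric] by (simp add: image_image image_comp)
  then show ?thesis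
    unfolding isomorphic_def using bij_betw_trans[OF f(1) g(1)] by blast
qed

lemma subgraph_complete_ugraph:
  "simple_graph G \<Longrightarrow> verts G \<subseteq> {1..n} \<Longrightarrow> subgraph G (complete_ugraph n)"
  unfolding subgraph_def simple_graph_def complete_ugraph_def
  using nsets_mono[of "verts G" "{1..n}" 2] by auto

text \<open>Together with \<open>finite_copies\<close> this makes
  \<open>pmf_of_set (copies n \<Gamma>)\<close> the uniform distribution on the copies. The bound on
  the number of vertices yields an injection into \<open>{1..n}\<close>, whose image graph is a
  copy.\<close>

lemma copies_nonempty:
  assumes "simple_graph \<Gamma>" "card (verts \<Gamma>) \<le> n"
  shows "copies n \<Gamma> \<noteq> {}"
proof -
  obtain f where f: "f ` verts \<Gamma> \<subseteq> {1..n}" "inj_on f (verts \<Gamma>)"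
    using card_le_inj[of "verts \<Gamma>" "{1..n}"] assms by (auto simp: simple_graph_def)
  have "subgraph (map_ugraph f \<Gamma>) (complete_ugraph n)"
    using simple_map_ugraph[OF f(2) assms(1)] f(1)
    by (intro subgraph_complete_ugraph) (simp_all add: map_ugraph_def)
  then have "map_ugraph f \<Gamma> \<in> copies n \<Gamma>"
    using isomorphic_map_ugraph[OF f(2)] by (simp add: copies_def)
  then show ?thesis by blast
qed

lemma map_ugraph_copies:
  assumes "\<sigma> permutes {1..n}" "H \<in> copies n \<Gamma>"
  shows "map_ugraph \<sigma> H \<in> copies n \<Gamma>"
proof -
  have H: "simple_graph H" "verts H \<subseteq> {1..n}" "isomorphic \<Gamma> H"
    using assms(2) by (auto simp: copies_def subgraph_def complete_ugraph_def)
  have inj: "inj_on \<sigma> (verts H)" using assms(1) by (meson inj_on_subset permutes_inj top_greatest)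
  have "\<sigma> ` verts H \<subseteq> {1..n}" using H(2) permutes_image[OF assms(1)] by blast
  then have "subgraph (map_ugraph \<sigma> H) (complete_ugraph n)"
    using simple_map_ugraph[OF inj H(1)] by (intro subgraph_complete_ugraph) (auto simp: map_ugraph_def)
  then show ?thesis
    using isomorphic_trans[OF H(3) isomorphic_map_ugraph[OF inj]] by (simp add: copies_def)
qed

lemma inj_map_ugraph:
  assumes "inj f"
  shows "inj (map_ugraph f)"
proof (rule injI)
  fix G H :: "'a ugraph" assume eq: "map_ugraph f G = map_ugraph f H"
  have "inj ((`) f)" using assms by (simp add: inj_def inj_image_eq_iff)
  then have "edges G = edges H" "verts G = verts H"
    using eq assms by (simp_all add: map_ugraph_def inj_image_eq_iff)
  then show "G = H" by simp
qed

text \<open>Carries the bounds assumed for \<open>\<Gamma>\<close> over to each of its copies. For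
  degrees, injectivity of the isomorphism shows that every edge at \<open>f u\<close> is the image
  of an edge at \<open>u\<close>.\<close>

lemma isomorphic_bounds:
  assumes "simple_graph G" "isomorphic G H"
  shows "card (edges H) \<le> card (edges G)" "max_degree H \<le> max_degree G"
proof -
  obtain f where f: "bij_betw f (verts G) (verts H)" "(`) f ` edges G = edges H"
    using assms(2) unfolding isomorphic_def by blast
  show "card (edges H) \<le> card (edges G)"
    unfolding f(2)[symmetric] by (rule card_image_le[OF finite_edges[OF assms(1)]])
  have "card {e \<in> edges H. v \<in> e} \<le> max_degree G" if "v \<in> verts H" for v
  proof -
    have "v \<in> f ` verts G" using that bij_betw_imp_surj_on[OF f(1)] by simp
    then obtain u where u: "u \<in> verts G" "v = f u" by blast
    have "{e \<in> edges H. v \<in> e} \<subseteq> (`) f ` {e \<in> edges G. u \<in> e}"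
    proof
      fix e assume e: "e \<in> {e \<in> edges H. v \<in> e}"
      then obtain d where d: "d \<in> edges G" "e = f ` d" using f(2) by blast
      then have "d \<subseteq> verts G" using assms(1) by (auto simp: simple_graph_def nsets_def)
      moreover have "f u \<in> f ` d" using e d(2) u(2) by simp
      then obtain x where "x \<in> d" "f x = f u" by (metis imageE)
      ultimately have "u \<in> d"
        using inj_onD[OF bij_betw_imp_inj_on[OF f(1)], of x u] u by blast
      then show "e \<in> (`) f ` {e \<in> edges G. u \<in> e}" using d by blast
    qed
    then have "card {e \<in> edges H. v \<in> e} \<le> card {e \<in> edges G. u \<in> e}"
      using finite_edges[OF assms(1)] by (intro surj_card_le) auto
    then show ?thesis using degree_le_max_degree[OF assms(1) u(1)] by linarith
  qed
  moreover have "finite (verts H)" 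
    using bij_betw_finite[OF f(1)] assms(1) by (simp add: simple_graph_def)
  ultimately show "max_degree H \<le> max_degree G"
    unfolding max_degree_def[of H] by (intro Max.boundedI) auto
qed

text \<open>If one extension \<open>\<tau>\<close> exists, composing any other one with the inverse
  of \<open>\<tau>\<close> gives a permutation that fixes \<open>V\<close> pointwise, that is, a
  permutation of \<open>A - V\<close>.\<close>

lemma card_permutations_extending_le:
  assumes "finite A" "V \<subseteq> A"
  shows "card {\<sigma>. \<sigma> permutes A \<and> (\<forall>x\<in>V. \<sigma> x = \<phi> x)} \<le> fact (card A - card V)"
proof (cases "\<exists>\<tau>. \<tau> permutes A \<and> (\<forall>x\<in>V. \<tau> x = \<phi> x)")
  case True
  then obtain \<tau> where \<tau>: "\<tau> permutes A" "\<And>x. x \<in> V \<Longrightarrow> \<tau> x = \<phi> x" by blast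
  have "card {\<sigma>. \<sigma> permutes A \<and> (\<forall>x\<in>V. \<sigma> x = \<phi> x)} \<le> card {\<sigma>. \<sigma> permutes A - V}"
  proof (rule card_inj_on_le)
    show "inj_on ((\<circ>) (inv \<tau>)) {\<sigma>. \<sigma> permutes A \<and> (\<forall>x\<in>V. \<sigma> x = \<phi> x)}"
    proof (rule inj_onI)
      fix f g assume "inv \<tau> \<circ> f = inv \<tau> \<circ> g"
      then have "\<tau> \<circ> (inv \<tau> \<circ> f) = \<tau> \<circ> (inv \<tau> \<circ> g)" by simp
      then show "f = g" by (simp add: o_assoc permutes_inv_o[OF \<tau>(1)])
    qed
    show "(\<circ>) (inv \<tau>) ` {\<sigma>. \<sigma> permutes A \<and> (\<forall>x\<in>V. \<sigma> x = \<phi> x)} \<subseteq> {\<sigma>. \<sigma> permutes A - V}"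
    proof safe
      fix \<sigma> assume \<sigma>: "\<sigma> permutes A" "\<forall>x\<in>V. \<sigma> x = \<phi> x"
      have "inv \<tau> \<circ> \<sigma> permutes A" by (rule permutes_compose[OF \<sigma>(1) permutes_inv[OF \<tau>(1)]])
      moreover have "(inv \<tau> \<circ> \<sigma>) x = x" if "x \<in> A - (A - V)" for x
        using that \<tau> \<sigma> by (metis DiffD1 DiffD2 DiffI comp_apply permutes_inverses(2))
      ultimately show "inv \<tau> \<circ> \<sigma> permutes A - V" by (rule permutes_superset)
    qed
  qed (use assms in \<open>auto intro: finite_permutations\<close>)
  also have "\<dots> = fact (card A - card V)"
    using assms by (intro card_permutations) (auto simp: card_Diff_subset finite_subset)
  finally show ?thesis .
next
  case False
  then have "{\<sigma>. \<sigma> permutes A \<and> (\<forall>x\<in>V. \<sigma> x = \<phi> x)} = {}" by blast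
  then show ?thesis by (metis card.empty le0)
qed

text \<open>Double counting of pairs of a permutation \<open>\<sigma>\<close> of
  \<open>{1..n}\<close> and a copy \<open>H\<close> that contains the image of \<open>S\<close>
  under \<open>\<sigma>\<close>. By symmetry every \<open>\<sigma>\<close> accounts for at least as
  many copies as contain \<open>S\<close> itself; for fixed \<open>H\<close> the permutations are
  counted through \<open>edge_maps\<close>.\<close>

lemma prob_copy_contains_le:
  assumes \<Gamma>: "simple_graph \<Gamma>" "card (verts \<Gamma>) \<le> n"
    and deg: "real (max_degree \<Gamma>) \<le> R" and edg: "2 * real (card (edges \<Gamma>)) \<le> R\<^sup>2"
    and S: "S \<subseteq> edges (complete_ugraph n)"
  shows "measure_pmf.prob (pmf_of_set (copies n \<Gamma>)) {H. S \<subseteq> edges H}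
    \<le> R ^ card (\<Union>S) * fact (n - card (\<Union>S)) / fact n"
proof -
  define V where "V = \<Union>S"
  define C where "C = copies n \<Gamma>"
  define T where "T = {\<sigma>. \<sigma> permutes {1..n}}"
  define hits where "hits \<sigma> H \<longleftrightarrow> (\<forall>e\<in>S. \<sigma> ` e \<in> edges H)" for \<sigma> :: "nat \<Rightarrow> nat" and H :: "nat ugraph"
  have R: "0 \<le> R" using deg by linarith
  have VA: "V \<subseteq> {1..n}" using S by (auto simp: V_def complete_ugraph_def nsets_def)
  then have fV: "finite V" by (rule finite_subset) simp
  have SV: "S \<subseteq> [V]\<^bsup>2\<^esup>"
    using S by (auto simp: V_def complete_ugraph_def nsets_def)
  have fC: "finite C" "C \<noteq> {}" using finite_copies copies_nonempty[OF \<Gamma>] by (auto simp: C_def)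
  have fT: "finite T" "card T = fact n"
    by (auto simp: T_def finite_permutations card_permutations)
  \<comment> \<open>Relabelling by \<open>\<sigma>\<close> maps copies to copies injectively and
    turns containment of \<open>S\<close> into containment of its image.\<close>
  have avg: "card {H \<in> C. S \<subseteq> edges H} \<le> card {H \<in> C. hits \<sigma> H}" if "\<sigma> \<in> T" for \<sigma>
  proof (rule card_inj_on_le)
    have \<sigma>: "\<sigma> permutes {1..n}" using that by (simp add: T_def)
    show "inj_on (map_ugraph \<sigma>) {H \<in> C. S \<subseteq> edges H}"
      using inj_map_ugraph[OF permutes_inj[OF \<sigma>]] by (rule inj_on_subset) simp
    show "map_ugraph \<sigma> ` {H \<in> C. S \<subseteq> edges H} \<subseteq> {H \<in> C. hits \<sigma> H}"
      using map_ugraph_copies[OF \<sigma>] by (auto simp: C_def hits_def map_ugraph_def)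
  qed (use fC in auto)
  have cnt: "real (card {\<sigma> \<in> T. hits \<sigma> H}) \<le> R ^ card V * fact (n - card V)" if "H \<in> C" for H
  proof -
    have H: "simple_graph H" "isomorphic \<Gamma> H" using that by (auto simp: C_def copies_def subgraph_def)
    \<comment> \<open>The restriction of such a \<open>\<sigma>\<close> to \<open>V\<close> is an
      edge map into \<open>H\<close>, and each edge map extends to at most
      \<open>(n - card V)!\<close> permutations.\<close>
    have "{\<sigma> \<in> T. hits \<sigma> H} \<subseteq>
        (\<Union>\<phi>\<in>edge_maps V S H. {\<sigma>. \<sigma> permutes {1..n} \<and> (\<forall>x\<in>V. \<sigma> x = \<phi> x)})"
    proof
      fix \<sigma> assume \<sigma>: "\<sigma> \<in> {\<sigma> \<in> T. hits \<sigma> H}"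
      have im: "restrict \<sigma> V ` e = \<sigma> ` e" if "e \<in> S" for e
        using that by (intro image_cong refl) (auto simp: V_def)
      have "\<sigma> x \<in> verts H" if "x \<in> V" for x
      proof -
        obtain e where "e \<in> S" "x \<in> e" using \<open>x \<in> V\<close> by (auto simp: V_def)
        then have "\<sigma> x \<in> \<sigma> ` e" "\<sigma> ` e \<in> [verts H]\<^bsup>2\<^esup>"
          using \<sigma> H(1) by (auto simp: hits_def simple_graph_def)
        then show ?thesis by (auto simp: nsets_def)
      qed
      then have "restrict \<sigma> V \<in> edge_maps V S H"
        using \<sigma> im by (auto simp: edge_maps_def hits_def)
      then show "\<sigma> \<in> (\<Union>\<phi>\<in>edge_maps V S H. {\<sigma>. \<sigma> permutes {1..n} \<and> (\<forall>x\<in>V. \<sigma> x = \<phi> x)})"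
        using \<sigma> by (intro UN_I[of "restrict \<sigma> V"]) (simp_all add: T_def)
    qed
    moreover have fin: "finite (edge_maps V S H)" by (rule finite_edge_maps[OF fV H(1)])
    ultimately have "card {\<sigma> \<in> T. hits \<sigma> H} \<le>
        card (\<Union>\<phi>\<in>edge_maps V S H. {\<sigma>. \<sigma> permutes {1..n} \<and> (\<forall>x\<in>V. \<sigma> x = \<phi> x)})"
      by (intro card_mono) (auto intro!: finite_subset[OF _ finite_permutations[of "{1..n}"]])
    also have "\<dots> \<le> (\<Sum>\<phi>\<in>edge_maps V S H. card {\<sigma>. \<sigma> permutes {1..n} \<and> (\<forall>x\<in>V. \<sigma> x = \<phi> x)})"
      by (rule card_UN_le[OF fin])
    also have "\<dots> \<le> (\<Sum>\<phi>\<in>edge_maps V S H. fact (n - card V))"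
      using card_permutations_extending_le[OF _ VA] by (intro sum_mono) simp
    finally have "card {\<sigma> \<in> T. hits \<sigma> H} \<le> card (edge_maps V S H) * fact (n - card V)" by simp
    then have "real (card {\<sigma> \<in> T. hits \<sigma> H}) \<le> real (card (edge_maps V S H) * fact (n - card V))"
      by (simp only: of_nat_le_iff)
    also have "\<dots> = real (card (edge_maps V S H)) * fact (n - card V)" by simp
    also have "\<dots> \<le> R ^ card V * fact (n - card V)"
      using isomorphic_bounds[OF \<Gamma>(1) H(2)] deg edg SV fV
      by (intro mult_right_mono card_edge_maps_le[OF H(1)]) (auto simp: V_def)
    finally show ?thesis .
  qed
  have "fact n * real (card {H \<in> C. S \<subseteq> edges H}) = (\<Sum>\<sigma>\<in>T. real (card {H \<in> C. S \<subseteq> edges H}))"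
    by (simp add: fT)
  also have "\<dots> \<le> (\<Sum>\<sigma>\<in>T. real (card {H \<in> C. hits \<sigma> H}))"
    using avg by (intro sum_mono) simp
  also have "\<dots> = (\<Sum>\<sigma>\<in>T. \<Sum>H\<in>C. of_bool (hits \<sigma> H))"
    by (simp add: sum.If_cases fC Int_def of_bool_def)
  also have "\<dots> = (\<Sum>H\<in>C. \<Sum>\<sigma>\<in>T. of_bool (hits \<sigma> H))" by (rule sum.swap)
  also have "\<dots> = (\<Sum>H\<in>C. real (card {\<sigma> \<in> T. hits \<sigma> H}))"
    by (simp add: sum.If_cases fT Int_def of_bool_def)
  also have "\<dots> \<le> (\<Sum>H\<in>C. R ^ card V * fact (n - card V))" using cnt by (rule sum_mono)
  finally have "fact n * real (card {H \<in> C. S \<subseteq> edges H}) \<le> real (card C) * (R ^ card V * fact (n - card V))"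
    by simp
  moreover have prob: "measure_pmf.prob (pmf_of_set C) {H. S \<subseteq> edges H}
      = real (card {H \<in> C. S \<subseteq> edges H}) / real (card C)"
    using fC by (simp add: measure_pmf_of_set Int_def)
  moreover have C: "0 < real (card C)" using fC by (simp add: card_gt_0_iff)
  ultimately have "real (card {H \<in> C. S \<subseteq> edges H}) \<le> R ^ card V * fact (n - card V) / fact n * real (card C)"
    by (simp add: pos_le_divide_eq mult_ac)
  then show ?thesis
    unfolding C_def[symmetric] V_def[symmetric] prob by (simp only: pos_divide_le_eq[OF C])
qed

section \<open>Fourier expansion of the low-degree likelihood ratio\<close>

abbreviation K :: "nat \<Rightarrow> nat set set" where
  "K n \<equiv> edges (complete_ugraph n)"

lemma finite_K: "finite (K n)"
  by (simp add: complete_ugraph_def finite_imp_finite_nsets)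

section \<open>The law of independent edges and expectations of products over edges\<close>

lemma set_independent_edges_subset: "set_pmf (independent_edges n w) \<subseteq> Pow (K n)"
  unfolding independent_edges_def by auto

lemma finite_set_independent_edges: "finite (set_pmf (independent_edges n w))"
  using set_independent_edges_subset by (rule finite_subset) (simp add: finite_K)

lemma pmf_independent_edges:
  assumes G: "G \<subseteq> K n" and w: "\<And>e. e \<in> K n \<Longrightarrow> 0 \<le> w e \<and> w e \<le> 1"
  shows "pmf (independent_edges n w) G = (\<Prod>e\<in>G. w e) * (\<Prod>e\<in>K n - G. 1 - w e)"
proof -
  let ?P = "Pi_pmf (K n) False (\<lambda>e. bernoulli_pmf (w e))"
  have "pmf (independent_edges n w) G = measure_pmf.prob ?P ((\<lambda>b. {e \<in> K n. b e}) -` {G})"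
    unfolding independent_edges_def by (rule pmf_map)
  \<comment> \<open>Coordinates outside \<open>K n\<close> are \<open>False\<close> almost surely
    under \<open>?P\<close>, so among the functions producing \<open>G\<close> only its indicator
    carries mass.\<close>
  also have "\<dots> = measure_pmf.prob ?P {\<lambda>e. e \<in> G}"
  proof (rule measure_prob_cong_0)
    fix b assume "b \<in> (\<lambda>b. {e \<in> K n. b e}) -` {G} - {\<lambda>e. e \<in> G}"
    then have "{e \<in> K n. b e} = G" "b \<noteq> (\<lambda>e. e \<in> G)" by auto
    then have "\<exists>e. e \<notin> K n \<and> b e" using G by auto
    then show "pmf ?P b = 0" by (intro pmf_Pi_outside) (auto simp: finite_K)
  qed (use G in auto)
  also have "\<dots> = pmf ?P (\<lambda>e. e \<in> G)" by (simp add: measure_pmf_single)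
  also have "\<dots> = (\<Prod>e\<in>K n. pmf (bernoulli_pmf (w e)) (e \<in> G))"
    using G by (intro pmf_Pi') (auto simp: finite_K)
  also have "\<dots> = (\<Prod>e\<in>G \<union> (K n - G). pmf (bernoulli_pmf (w e)) (e \<in> G))"
    using G by (simp add: Un_absorb1)
  also have "\<dots> = (\<Prod>e\<in>G. pmf (bernoulli_pmf (w e)) (e \<in> G)) * (\<Prod>e\<in>K n - G. pmf (bernoulli_pmf (w e)) (e \<in> G))"
    by (rule prod.union_disjoint) (use finite_K[of n] finite_subset[OF G] in auto)
  also have "\<dots> = (\<Prod>e\<in>G. w e) * (\<Prod>e\<in>K n - G. 1 - w e)"
    using G w by (intro arg_cong2[of _ _ _ _ "(*)"] prod.cong) auto
  finally show ?thesis .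
qed

lemma set_erdos_renyi:
  assumes "0 < q" "q < 1"
  shows "set_pmf (erdos_renyi n q) = Pow (K n)"
proof
  show "Pow (K n) \<subseteq> set_pmf (erdos_renyi n q)"
    using assms by (auto simp: erdos_renyi_def set_pmf_iff pmf_independent_edges)
qed (simp add: erdos_renyi_def set_independent_edges_subset)

text \<open>Independence in product form: the sum over all graphs \<open>G\<close> of products over
  \<open>G\<close> and over its complement is the expansion of a product of two-term sums.\<close>

lemma expectation_independent_edges:
  fixes f :: "nat set \<Rightarrow> bool \<Rightarrow> real"
  assumes w: "\<And>e. e \<in> K n \<Longrightarrow> 0 \<le> w e \<and> w e \<le> 1"
  shows "measure_pmf.expectation (independent_edges n w) (\<lambda>G. \<Prod>e\<in>K n. f e (e \<in> G))
    = (\<Prod>e\<in>K n. w e * f e True + (1 - w e) * f e False)"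
proof -
  have "measure_pmf.expectation (independent_edges n w) (\<lambda>G. \<Prod>e\<in>K n. f e (e \<in> G))
      = (\<Sum>G\<in>Pow (K n). (\<Prod>e\<in>K n. f e (e \<in> G)) * pmf (independent_edges n w) G)"
    by (rule integral_measure_pmf_real) (use finite_K set_independent_edges_subset[of n w] in auto)
  also have "\<dots> = (\<Sum>G\<in>Pow (K n). (\<Prod>e\<in>G. w e * f e True) * (\<Prod>e\<in>K n - G. (1 - w e) * f e False))"
  proof (rule sum.cong[OF refl])
    fix G assume "G \<in> Pow (K n)"
    then have G: "G \<subseteq> K n" by simp
    have "(\<Prod>e\<in>K n. f e (e \<in> G)) = (\<Prod>e\<in>G \<union> (K n - G). f e (e \<in> G))"
      using G by (simp add: Un_absorb1)
    also have "\<dots> = (\<Prod>e\<in>G. f e (e \<in> G)) * (\<Prod>e\<in>K n - G. f e (e \<in> G))"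
      by (rule prod.union_disjoint) (use finite_K[of n] finite_subset[OF G] in auto)
    also have "\<dots> = (\<Prod>e\<in>G. f e True) * (\<Prod>e\<in>K n - G. f e False)"
      by (intro arg_cong2[of _ _ _ _ "(*)"] prod.cong) auto
    finally show "(\<Prod>e\<in>K n. f e (e \<in> G)) * pmf (independent_edges n w) G
        = (\<Prod>e\<in>G. w e * f e True) * (\<Prod>e\<in>K n - G. (1 - w e) * f e False)"
      by (simp add: pmf_independent_edges[OF G w] prod.distrib mult_ac)
  qed
  also have "\<dots> = (\<Prod>e\<in>K n. w e * f e True + (1 - w e) * f e False)"
    by (rule prod_add[OF finite_K, symmetric])
  finally show ?thesis .
qed

text \<open>The \<open>q\<close>-biased Fourier characters: products of edge indicators normalised
  to mean 0 and variance 1 under the null hypothesis.\<close>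

definition chi :: "real \<Rightarrow> nat set set \<Rightarrow> nat set set \<Rightarrow> real" where
  "chi q S G = (\<Prod>e\<in>S. (of_bool (e \<in> G) - q) / sqrt (q * (1 - q)))"

text \<open>Padding with factors 1 brings the character into the form required by
  \<open>expectation_independent_edges\<close>.\<close>

lemma chi_eq_prod_K:
  "S \<subseteq> K n \<Longrightarrow> chi q S G = (\<Prod>e\<in>K n. if e \<in> S then (of_bool (e \<in> G) - q) / sqrt (q * (1 - q)) else 1)"
  unfolding chi_def by (simp add: prod.If_cases finite_K Int_absorb1)

lemma expectation_chi:
  assumes S: "S \<subseteq> K n" and w: "\<And>e. e \<in> K n \<Longrightarrow> 0 \<le> w e \<and> w e \<le> 1"
  shows "measure_pmf.expectation (independent_edges n w) (chi q S)
    = (\<Prod>e\<in>S. (w e - q) / sqrt (q * (1 - q)))"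
proof -
  let ?f = "\<lambda>e b. if e \<in> S then (of_bool b - q) / sqrt (q * (1 - q)) else 1"
  have "measure_pmf.expectation (independent_edges n w) (chi q S)
      = (\<Prod>e\<in>K n. w e * ?f e True + (1 - w e) * ?f e False)"
    unfolding chi_eq_prod_K[OF S, abs_def]
    by (rule expectation_independent_edges[OF w, of n "\<lambda>e. e" ?f]) simp
  also have "\<dots> = (\<Prod>e\<in>K n. if e \<in> S then (w e - q) / sqrt (q * (1 - q)) else 1)"
    by (intro prod.cong) (auto simp: add_divide_distrib[symmetric] algebra_simps)
  also have "\<dots> = (\<Prod>e\<in>S. (w e - q) / sqrt (q * (1 - q)))"
    using S by (simp add: prod.If_cases finite_K Int_absorb1)
  finally show ?thesis .
qed

text \<open>The inner product factorises over the edges. An edge in both sets contributes the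
  variance 1, an edge in neither contributes 1, and an edge in exactly one contributes the mean 0,
  which annihilates the product when \<open>S\<close> and \<open>T\<close> differ.\<close>

lemma chi_orthonormal:
  assumes q: "0 < q" "q < 1" and S: "S \<subseteq> K n" and T: "T \<subseteq> K n"
  shows "inner_pmf (erdos_renyi n q) (chi q S) (chi q T) = of_bool (S = T)"
proof -
  define s where "s = sqrt (q * (1 - q))"
  have s: "s * s = q * (1 - q)" "s \<noteq> 0" using q by (auto simp: s_def)
  let ?f = "\<lambda>e b. (if e \<in> S then (of_bool b - q) / s else 1) * (if e \<in> T then (of_bool b - q) / s else 1)"
  have "inner_pmf (erdos_renyi n q) (chi q S) (chi q T)
      = measure_pmf.expectation (independent_edges n (\<lambda>_. q)) (\<lambda>G. \<Prod>e\<in>K n. ?f e (e \<in> G))"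
    unfolding inner_pmf_def erdos_renyi_def chi_eq_prod_K[OF S] chi_eq_prod_K[OF T]
      s_def[symmetric] by (simp only: prod.distrib)
  also have "\<dots> = (\<Prod>e\<in>K n. q * ?f e True + (1 - q) * ?f e False)"
    by (rule expectation_independent_edges) (use q in simp)
  also have "\<dots> = (\<Prod>e\<in>K n. of_bool (e \<in> S \<longleftrightarrow> e \<in> T))"
  proof (rule prod.cong[OF refl])
    fix e
    have "q * ((1 - q) / s * ((1 - q) / s)) + (1 - q) * (- q / s * (- q / s)) = q * (1 - q) * (1 - q + q) / (s * s)"
      by (simp add: add_divide_distrib[symmetric] algebra_simps)
    also have "\<dots> = 1" using q by (simp add: s(1))
    finally have both: "q * ((1 - q) / s * ((1 - q) / s)) + (1 - q) * (- q / s * (- q / s)) = 1" .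
    have "q * ((1 - q) / s) + (1 - q) * (- q / s) = 0"
      by (simp add: add_divide_distrib[symmetric] algebra_simps)
    with both show "q * ?f e True + (1 - q) * ?f e False = of_bool (e \<in> S \<longleftrightarrow> e \<in> T)"
      by auto
  qed
  also have "\<dots> = of_bool (S = T)"
  proof (cases "S = T")
    case False
    then obtain e where "e \<in> K n" "\<not> (e \<in> S \<longleftrightarrow> e \<in> T)" using S T by blast
    then show ?thesis using False finite_K by (auto intro!: prod_zero)
  qed auto
  finally show ?thesis .
qed

text \<open>Given the copy \<open>H\<close>, an edge outside \<open>H\<close> has a normalised
  indicator of mean 0, so the character survives only if \<open>S\<close> lies in \<open>H\<close>.
  Then each of its edges contributes the same mean, whose square is
  \<open>chi_square p q\<close>.\<close>

lemma expectation_planted_chi: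
  assumes \<Gamma>: "simple_graph \<Gamma>" "card (verts \<Gamma>) \<le> n"
    and q: "0 < q" "q < 1" and p: "0 \<le> p" "p \<le> 1" and S: "S \<subseteq> K n"
  shows "measure_pmf.expectation (planted_graph \<Gamma> n p q) (chi q S)
    = ((p - q) / sqrt (q * (1 - q))) ^ card S * measure_pmf.prob (pmf_of_set (copies n \<Gamma>)) {H. S \<subseteq> edges H}"
proof -
  define C where "C = copies n \<Gamma>"
  define l where "l = (p - q) / sqrt (q * (1 - q))"
  have C: "finite C" "C \<noteq> {}" using finite_copies copies_nonempty[OF \<Gamma>] by (auto simp: C_def)
  have fS: "finite S" using S finite_K by (rule finite_subset)
  have "measure_pmf.expectation (planted_graph \<Gamma> n p q) (chi q S)
      = (\<Sum>H\<in>C. measure_pmf.expectation (independent_edges n (\<lambda>e. if e \<in> edges H then p else q)) (chi q S) /\<^sub>R real (card C))"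
    unfolding planted_graph_def C_def[symmetric]
    by (rule pmf_expectation_bind_pmf_of_set[OF C(2,1)]) (rule finite_set_independent_edges)
  also have "\<dots> = (\<Sum>H\<in>C. l ^ card S * of_bool (S \<subseteq> edges H) / real (card C))"
  proof (rule sum.cong[OF refl])
    fix H
    have "measure_pmf.expectation (independent_edges n (\<lambda>e. if e \<in> edges H then p else q)) (chi q S)
        = (\<Prod>e\<in>S. if e \<in> edges H then l else 0)"
      using q p by (subst expectation_chi[OF S]) (auto simp: l_def intro!: prod.cong)
    also have "\<dots> = l ^ card S * of_bool (S \<subseteq> edges H)"
    proof (cases "S \<subseteq> edges H")
      case True
      then have "(\<Prod>e\<in>S. if e \<in> edges H then l else 0) = (\<Prod>e\<in>S. l)" by (intro prod.cong) auto
      then show ?thesis using True by simp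
    next
      case False
      then show ?thesis using fS by (auto intro!: prod_zero)
    qed
    finally show "measure_pmf.expectation (independent_edges n (\<lambda>e. if e \<in> edges H then p else q)) (chi q S) /\<^sub>R real (card C)
        = l ^ card S * of_bool (S \<subseteq> edges H) / real (card C)"
      by (simp add: divide_inverse mult_ac)
  qed
  also have "\<dots> = l ^ card S * ((\<Sum>H\<in>C. of_bool (S \<subseteq> edges H)) / real (card C))"
    by (simp add: sum_distrib_left sum_divide_distrib)
  also have "(\<Sum>H\<in>C. of_bool (S \<subseteq> edges H)) = real (card {H \<in> C. S \<subseteq> edges H})"
    using C by (simp add: sum.If_cases Int_def of_bool_def)
  also have "real (card {H \<in> C. S \<subseteq> edges H}) / real (card C) = measure_pmf.prob (pmf_of_set C) {H. S \<subseteq> edges H}"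
    using C by (simp add: measure_pmf_of_set Int_def)
  finally show ?thesis by (simp add: l_def C_def)
qed

section \<open>Likelihood ratios and inner products of discrete distributions\<close>

lemma absolutely_continuous_pmf:
  assumes "set_pmf Q \<subseteq> set_pmf P"
  shows "absolutely_continuous (measure_pmf P) (measure_pmf Q)"
  unfolding absolutely_continuous_def
proof
  fix A assume "A \<in> null_sets (measure_pmf P)"
  then have "AE x in measure_pmf P. x \<notin> A" by (rule AE_not_in)
  then have "A \<inter> set_pmf Q = {}" using assms by (auto simp: AE_measure_pmf_iff)
  then show "A \<in> null_sets (measure_pmf Q)" by (rule in_null_sets_measure_pmfI)
qed

text \<open>The Radon-Nikodym identity evaluated at a singleton. The product form also covers points
  of mass 0, where a quotient would be meaningless.\<close>

lemma likelihood_ratio_times_pmf: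
  assumes "set_pmf Q \<subseteq> set_pmf P"
  shows "likelihood_ratio P Q x * pmf P x = pmf Q x"
proof -
  have "measure_pmf Q = density (measure_pmf P) (RN_deriv (measure_pmf P) (measure_pmf Q))"
    using absolutely_continuous_pmf[OF assms] by (simp add: measure_pmf.density_RN_deriv)
  then have "emeasure (measure_pmf Q) {x} = emeasure (density (measure_pmf P) (RN_deriv (measure_pmf P) (measure_pmf Q))) {x}"
    by simp
  also have "\<dots> = (\<integral>\<^sup>+y. RN_deriv (measure_pmf P) (measure_pmf Q) y * indicator {x} y \<partial>measure_pmf P)"
    by (rule emeasure_density) auto
  also have "\<dots> = RN_deriv (measure_pmf P) (measure_pmf Q) x * ennreal (pmf P x)"
    by (subst nn_integral_indicator_singleton) (auto simp: emeasure_pmf_single)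
  finally have "ennreal (pmf Q x) = RN_deriv (measure_pmf P) (measure_pmf Q) x * ennreal (pmf P x)"
    by (simp add: emeasure_pmf_single)
  then have "enn2real (ennreal (pmf Q x)) = enn2real (RN_deriv (measure_pmf P) (measure_pmf Q) x * ennreal (pmf P x))"
    by simp
  then show ?thesis by (simp add: likelihood_ratio_def enn2real_mult)
qed

text \<open>Change of measure: the Fourier coefficients of the likelihood ratio are the expectations
  of the characters under the alternative.\<close>

lemma inner_likelihood_ratio:
  assumes "set_pmf Q \<subseteq> set_pmf P" "finite (set_pmf P)"
  shows "inner_pmf P (likelihood_ratio P Q) h = measure_pmf.expectation Q h"
proof -
  have "inner_pmf P (likelihood_ratio P Q) h = (\<Sum>x\<in>set_pmf P. likelihood_ratio P Q x * h x * pmf P x)"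
    unfolding inner_pmf_def by (rule integral_measure_pmf_real) (use assms in auto)
  also have "\<dots> = (\<Sum>x\<in>set_pmf P. h x * pmf Q x)"
    by (simp add: likelihood_ratio_times_pmf[OF assms(1), symmetric] mult_ac)
  also have "\<dots> = measure_pmf.expectation Q h"
    by (rule integral_measure_pmf_real[symmetric]) (use assms in auto)
  finally show ?thesis .
qed

lemma inner_pmf_commute: "inner_pmf P f g = inner_pmf P g f"
  by (simp add: inner_pmf_def mult.commute)

lemma inner_pmf_diff_left:
  "finite (set_pmf P) \<Longrightarrow> inner_pmf P (\<lambda>x. f x - g x) h = inner_pmf P f h - inner_pmf P g h"
  unfolding inner_pmf_def
  by (simp add: left_diff_distrib Bochner_Integration.integral_diff integrable_measure_pmf_finite)

lemma inner_pmf_sum_right: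
  "finite (set_pmf P) \<Longrightarrow> inner_pmf P f (\<lambda>x. \<Sum>i\<in>I. a i * h i x) = (\<Sum>i\<in>I. a i * inner_pmf P f (h i))"
  unfolding inner_pmf_def
  by (simp add: sum_distrib_left Bochner_Integration.integral_sum integrable_measure_pmf_finite
      mult.left_commute)

section \<open>Change of basis between monomials and characters\<close>

lemma prod_mset_of_bool: "(\<Prod>e\<in>#m. of_bool (e \<in> G)) = (of_bool (set_mset m \<subseteq> G) :: real)"
  by (induction m) auto

lemma prod_of_bool: "finite T \<Longrightarrow> (\<Prod>e\<in>T. of_bool (e \<in> G)) = (of_bool (T \<subseteq> G) :: real)"
  by (induction T rule: finite_induct) auto

text \<open>Write each indicator as a multiple of its normalised version plus \<open>q\<close> and
  expand the product. Only subsets of \<open>T\<close> occur, so the degree does not grow.\<close>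

lemma of_bool_subset_eq_sum_chi:
  assumes q: "0 < q" "q < 1" and T: "finite T"
  shows "of_bool (T \<subseteq> G) = (\<Sum>S\<in>Pow T. sqrt (q * (1 - q)) ^ card S * q ^ card (T - S) * chi q S G)"
proof -
  define s where "s = sqrt (q * (1 - q))"
  have s: "s \<noteq> 0" using q by (auto simp: s_def)
  have "of_bool (T \<subseteq> G) = (\<Prod>e\<in>T. s * ((of_bool (e \<in> G) - q) / s) + q)"
    using s by (simp add: prod_of_bool[OF T, symmetric])
  also have "\<dots> = (\<Sum>S\<in>Pow T. (\<Prod>e\<in>S. s * ((of_bool (e \<in> G) - q) / s)) * (\<Prod>e\<in>T - S. q))"
    by (rule prod_add[OF T])
  also have "\<dots> = (\<Sum>S\<in>Pow T. s ^ card S * q ^ card (T - S) * chi q S G)"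
    by (rule sum.cong[OF refl])
      (simp only: prod.distrib prod_constant chi_def s_def[symmetric] mult_ac)
  finally show ?thesis by (simp add: s_def)
qed

text \<open>The reverse expansion, again over subsets only; it places the characters in the space of
  low-degree polynomials.\<close>

lemma chi_eq_sum_of_bool_subset:
  assumes S: "finite S"
  shows "chi q S G = (\<Sum>T\<in>Pow S. (1 / sqrt (q * (1 - q))) ^ card T * (- q / sqrt (q * (1 - q))) ^ card (S - T) * of_bool (T \<subseteq> G))"
proof -
  define s where "s = sqrt (q * (1 - q))"
  have "chi q S G = (\<Prod>e\<in>S. 1 / s * of_bool (e \<in> G) + - q / s)"
    unfolding chi_def s_def[symmetric] by (intro prod.cong) (simp_all add: diff_divide_distrib)
  also have "\<dots> = (\<Sum>T\<in>Pow S. (\<Prod>e\<in>T. 1 / s * of_bool (e \<in> G)) * (\<Prod>e\<in>S - T. - q / s))"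
    by (rule prod_add[OF S])
  also have "\<dots> = (\<Sum>T\<in>Pow S. (1 / s) ^ card T * (- q / s) ^ card (S - T) * of_bool (T \<subseteq> G))"
  proof (rule sum.cong[OF refl])
    fix T assume "T \<in> Pow S"
    then have T: "finite T" using S finite_subset by blast
    show "(\<Prod>e\<in>T. 1 / s * of_bool (e \<in> G)) * (\<Prod>e\<in>S - T. - q / s)
        = (1 / s) ^ card T * (- q / s) ^ card (S - T) * of_bool (T \<subseteq> G)"
      by (simp only: prod.distrib prod_constant prod_of_bool[OF T] mult_ac)
  qed
  finally show ?thesis by (simp add: s_def)
qed

definition small_edge_sets :: "nat \<Rightarrow> nat \<Rightarrow> nat set set set" where
  "small_edge_sets n D = {S. S \<subseteq> K n \<and> card S \<le> D}"

lemma finite_small_edge_sets: "finite (small_edge_sets n D)"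
  unfolding small_edge_sets_def by (rule finite_subset[of _ "Pow (K n)"]) (auto simp: finite_K)

section \<open>The space of low-degree polynomials and its projection\<close>

lemma low_degree_scale:
  assumes "f \<in> low_degree_polynomials n D"
  shows "(\<lambda>G. c * f G) \<in> low_degree_polynomials n D"
proof -
  obtain a where "f = (\<lambda>G. \<Sum>m\<in>monomials n D. a m * (\<Prod>e\<in>#m. of_bool (e \<in> G)))"
    using assms unfolding low_degree_polynomials_def by blast
  then show ?thesis
    unfolding low_degree_polynomials_def mem_Collect_eq
    by (intro exI[of _ "\<lambda>m. c * a m"]) (simp add: sum_distrib_left mult.assoc)
qed

lemma low_degree_add:
  assumes "f \<in> low_degree_polynomials n D" "g \<in> low_degree_polynomials n D"
  shows "(\<lambda>G. f G + g G) \<in> low_degree_polynomials n D"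
proof -
  obtain a b where "f = (\<lambda>G. \<Sum>m\<in>monomials n D. a m * (\<Prod>e\<in>#m. of_bool (e \<in> G)))"
    "g = (\<lambda>G. \<Sum>m\<in>monomials n D. b m * (\<Prod>e\<in>#m. of_bool (e \<in> G)))"
    using assms unfolding low_degree_polynomials_def by blast
  then show ?thesis
    unfolding low_degree_polynomials_def mem_Collect_eq
    by (intro exI[of _ "\<lambda>m. a m + b m"]) (simp add: sum.distrib distrib_right)
qed

lemma low_degree_sum:
  assumes "finite I" "\<And>i. i \<in> I \<Longrightarrow> h i \<in> low_degree_polynomials n D"
  shows "(\<lambda>G. \<Sum>i\<in>I. c i * h i G) \<in> low_degree_polynomials n D"
  using assms
proof (induction I rule: finite_induct)
  case empty
  show ?case
    unfolding low_degree_polynomials_def mem_Collect_eq by (intro exI[of _ "\<lambda>_. 0"]) simp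
next
  case (insert i I)
  then have "(\<lambda>G. c i * h i G + (\<Sum>i\<in>I. c i * h i G)) \<in> low_degree_polynomials n D"
    by (intro low_degree_add low_degree_scale) auto
  with insert.hyps show ?case by simp
qed

lemma low_degree_of_bool_subset:
  assumes "T \<in> small_edge_sets n D"
  shows "(\<lambda>G. of_bool (T \<subseteq> G)) \<in> low_degree_polynomials n D"
proof -
  have T: "T \<subseteq> K n" "card T \<le> D" "finite T"
    using assms finite_K finite_subset by (auto simp: small_edge_sets_def)
  then have "mset_set T \<in> monomials n D" by (simp add: monomials_def)
  then show ?thesis
    unfolding low_degree_polynomials_def mem_Collect_eq
    by (intro exI[of _ "\<lambda>m. of_bool (m = mset_set T)"])
      (simp add: prod_mset_of_bool finite_monomials T(3))
qed

lemma low_degree_chi: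
  assumes "S \<in> small_edge_sets n D"
  shows "chi q S \<in> low_degree_polynomials n D"
proof -
  have S: "S \<subseteq> K n" "card S \<le> D" "finite S"
    using assms finite_K finite_subset by (auto simp: small_edge_sets_def)
  have "T \<in> small_edge_sets n D" if "T \<in> Pow S" for T
    using that S card_mono[of S T] by (auto simp: small_edge_sets_def)
  then show ?thesis
    unfolding chi_eq_sum_of_bool_subset[OF S(3), abs_def]
    using S(3) by (intro low_degree_sum low_degree_of_bool_subset) auto
qed

text \<open>Orthogonality need only be tested on characters: indicators are idempotent, so a
  monomial depends on its support alone, which has at most \<open>D\<close> edges and expands into
  characters of its subsets.\<close>

lemma inner_low_degree_eq_0:
  assumes q: "0 < q" "q < 1" and P: "finite (set_pmf P)"
    and orth: "\<And>S. S \<in> small_edge_sets n D \<Longrightarrow> inner_pmf P f (chi q S) = 0"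
    and h: "h \<in> low_degree_polynomials n D"
  shows "inner_pmf P f h = 0"
proof -
  obtain a where a: "h = (\<lambda>G. \<Sum>m\<in>monomials n D. a m * (\<Prod>e\<in>#m. of_bool (e \<in> G)))"
    using h unfolding low_degree_polynomials_def by blast
  have "inner_pmf P f (\<lambda>G. \<Prod>e\<in>#m. of_bool (e \<in> G)) = 0" if m: "m \<in> monomials n D" for m
  proof -
    have "card (set_mset m) \<le> size m"
      by (metis card_mono finite_set_mset mset_set_set_mset_msubset size_mset_mono size_mset_set)
    then have "S \<in> small_edge_sets n D" if "S \<in> Pow (set_mset m)" for S
      using that m card_mono[of "set_mset m" S] by (auto simp: small_edge_sets_def monomials_def)
    then show ?thesis
      unfolding prod_mset_of_bool of_bool_subset_eq_sum_chi[OF q finite_set_mset]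
      by (simp add: inner_pmf_sum_right[OF P] orth)
  qed
  then show ?thesis unfolding a by (simp add: inner_pmf_sum_right[OF P])
qed

text \<open>Parseval's identity for the truncated Fourier expansion of the likelihood ratio, whose
  coefficients are computed by \<open>inner_likelihood_ratio\<close>.\<close>

lemma norm_low_degree_likelihood_ratio:
  assumes q: "0 < q" "q < 1" and Q: "set_pmf Q \<subseteq> Pow (K n)"
  shows "(norm_pmf (erdos_renyi n q) (low_degree_likelihood_ratio n (erdos_renyi n q) Q D))\<^sup>2
    = (\<Sum>S\<in>small_edge_sets n D. (measure_pmf.expectation Q (chi q S))\<^sup>2)"
proof -
  define P where "P = erdos_renyi n q"
  define L where "L = likelihood_ratio P Q"
  define V where "V = low_degree_polynomials n D"
  define c where "c S = measure_pmf.expectation Q (chi q S)" for S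
  \<comment> \<open>An explicit projection, the truncated Fourier expansion.\<close>
  define g where "g G = (\<Sum>S\<in>small_edge_sets n D. c S * chi q S G)" for G
  have P: "finite (set_pmf P)" "set_pmf Q \<subseteq> set_pmf P"
    using Q by (auto simp: P_def set_erdos_renyi[OF q] finite_K)
  have gchi: "inner_pmf P g (chi q T) = c T" if T: "T \<in> small_edge_sets n D" for T
  proof -
    have "inner_pmf P g (chi q T) = (\<Sum>S\<in>small_edge_sets n D. c S * inner_pmf P (chi q T) (chi q S))"
      unfolding inner_pmf_commute[of P g] g_def by (rule inner_pmf_sum_right[OF P(1)])
    also have "\<dots> = (\<Sum>S\<in>small_edge_sets n D. c S * of_bool (T = S))"
      using T by (intro sum.cong refl) (auto simp: P_def chi_orthonormal[OF q] small_edge_sets_def)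
    also have "\<dots> = c T" using T by (simp add: finite_small_edge_sets)
    finally show ?thesis .
  qed
  have gV: "g \<in> V"
    unfolding g_def[abs_def] V_def by (intro low_degree_sum finite_small_edge_sets low_degree_chi)
  have g: "inner_pmf P (\<lambda>G. L G - g G) h = 0" if "h \<in> V" for h
  proof (rule inner_low_degree_eq_0[OF q P(1) _ that[unfolded V_def]])
    fix S assume "S \<in> small_edge_sets n D"
    then show "inner_pmf P (\<lambda>G. L G - g G) (chi q S) = 0"
      unfolding inner_pmf_diff_left[OF P(1)] gchi L_def inner_likelihood_ratio[OF P(2,1)]
      by (simp only: gchi c_def)
  qed
  \<comment> \<open>The projection selected by \<open>SOME\<close> is known only through its
    specification. Both \<open>g\<close> and \<open>g'\<close> lie in \<open>V\<close> and have the
    same inner products with \<open>V\<close> as \<open>L\<close>, so their norms agree.\<close>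
  define g' where "g' = orthogonal_projection P V L"
  have "g' \<in> V \<and> (\<forall>h\<in>V. inner_pmf P (\<lambda>G. L G - g' G) h = 0)"
    unfolding g'_def orthogonal_projection_def by (rule someI[of _ g]) (use g gV in blast)
  then have g': "g' \<in> V" "\<And>h. h \<in> V \<Longrightarrow> inner_pmf P g' h = inner_pmf P L h"
    by (auto simp: inner_pmf_diff_left[OF P(1)])
  have gL: "inner_pmf P g h = inner_pmf P L h" if "h \<in> V" for h
    using g[OF that] by (simp add: inner_pmf_diff_left[OF P(1)])
  have "inner_pmf P g' g' = inner_pmf P g g'" using g' gL by simp
  also have "\<dots> = inner_pmf P g g" using g'(2)[OF gV] gL[OF gV] by (simp add: inner_pmf_commute)
  also have "\<dots> = (\<Sum>S\<in>small_edge_sets n D. c S * inner_pmf P g (chi q S))"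
    unfolding g_def[of _, abs_def] by (rule inner_pmf_sum_right[OF P(1)])
  also have "\<dots> = (\<Sum>S\<in>small_edge_sets n D. (c S)\<^sup>2)"
    by (simp add: gchi power2_eq_square)
  finally have "inner_pmf P g' g' = (\<Sum>S\<in>small_edge_sets n D. (c S)\<^sup>2)" .
  then show ?thesis
    unfolding norm_pmf_def low_degree_likelihood_ratio_def P_def[symmetric] V_def[symmetric]
      L_def[symmetric] g'_def[symmetric] c_def[symmetric]
    by (simp add: sum_nonneg)
qed

section \<open>Bounding the sum of squared Fourier coefficients\<close>

lemma sum_Pow_power_card:
  fixes x :: real
  assumes "finite A"
  shows "(\<Sum>S\<in>Pow A. x ^ card S) = (1 + x) ^ card A"
  using prod_add[OF assms, of "\<lambda>_. x" "\<lambda>_. 1"] by (simp add: add.commute)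

lemma sum_small_subsets_le:
  fixes X y :: real
  assumes A: "finite A" and X: "0 \<le> X" and y: "1 \<le> y"
  shows "(\<Sum>S\<in>{S \<in> Pow A. card S \<le> D}. X ^ card S) \<le> y ^ D * (1 + X / y) ^ card A"
proof -
  have "(\<Sum>S\<in>{S \<in> Pow A. card S \<le> D}. X ^ card S) \<le> (\<Sum>S\<in>{S \<in> Pow A. card S \<le> D}. y ^ D * (X / y) ^ card S)"
  proof (rule sum_mono)
    fix S assume "S \<in> {S \<in> Pow A. card S \<le> D}"
    then have "y ^ card S * (X / y) ^ card S \<le> y ^ D * (X / y) ^ card S"
      using X y by (intro mult_right_mono power_increasing) auto
    then show "X ^ card S \<le> y ^ D * (X / y) ^ card S"
      using y by (simp add: power_divide)
  qed
  also have "\<dots> \<le> (\<Sum>S\<in>Pow A. y ^ D * (X / y) ^ card S)"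
    using A X y by (intro sum_mono2) auto
  also have "\<dots> = y ^ D * (1 + X / y) ^ card A"
    by (simp add: sum_distrib_left[symmetric] sum_Pow_power_card[OF A])
  finally show ?thesis .
qed

text \<open>The exponent \<open>3/2\<close> exceeds 1, as the conjecture demands, and is below 2, so
  that \<open>D ln D\<close> is of smaller order than \<open>(ln n)\<^sup>2\<close>.\<close>

definition log_degree :: "nat \<Rightarrow> nat" where
  "log_degree n = nat \<lceil>ln (real n) powr (3/2)\<rceil>"

lemma log_degree_bounds:
  "ln (real n) powr (3/2) \<le> real (log_degree n)" "real (log_degree n) \<le> ln (real n) powr (3/2) + 1"
proof -
  have "0 \<le> ln (real n) powr (3/2)" by simp
  then show "ln (real n) powr (3/2) \<le> real (log_degree n)" "real (log_degree n) \<le> ln (real n) powr (3/2) + 1"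
    unfolding log_degree_def by linarith+
qed

text \<open>On \<open>v\<close> vertices with \<open>v \<le> c ln n\<close> all graphs are counted, on more vertices only those with
  at most \<open>log_degree n\<close> edges.\<close>

lemma eventually_sum_small_graphs_le:
  fixes X a :: real
  assumes X: "1 \<le> X" and a: "0 < a"
  shows "\<forall>\<^sub>F n in sequentially. \<forall>V :: 'b set. finite V \<longrightarrow> card V \<le> 2 * log_degree n \<longrightarrow>
    (\<Sum>S\<in>{S \<in> Pow ([V]\<^bsup>2\<^esup>). card S \<le> log_degree n}. X ^ card S) \<le> (real n powr a) ^ card V"
proof -
  \<comment> \<open>With this threshold, \<open>v \<le> c ln n\<close> gives
    \<open>(1 + X) ^ (v\<^sup>2) \<le> n powr (a * v)\<close>.\<close>
  define c where "c = a / ln (1 + X)"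
  have lnX: "0 < ln (1 + X)" using X by simp
  have c: "0 < c" "c * ln (1 + X) = a" using lnX a by (auto simp: c_def)
  have b: "0 < a * c" using a c by simp
  \<comment> \<open>The left side bounds \<open>D ln y + 1\<close> for the \<open>y\<close> chosen
    below and has order \<open>(ln n) powr (3/2)\<close> times \<open>ln (ln n)\<close>.\<close>
  have "\<forall>\<^sub>F n :: nat in sequentially. (ln n powr (3/2) + 1) * ln (4 * X * (ln n powr (3/2) + 1)\<^sup>2) + 1 \<le> a * c * (ln n)\<^sup>2"
    using X b by real_asymp
  then show ?thesis
    using eventually_gt_at_top[of 1]
  proof (eventually_elim, intro allI impI)
    fix n :: nat and V :: "'b set"
    assume ev: "(ln n powr (3/2) + 1) * ln (4 * X * (ln n powr (3/2) + 1)\<^sup>2) + 1 \<le> a * c * (ln n)\<^sup>2"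
      and n: "1 < n" and V: "finite V" "card V \<le> 2 * log_degree n"
    define D where "D = log_degree n"
    define v where "v = card V"
    define N where "N = card ([V]\<^bsup>2\<^esup>)"
    have fin: "finite ([V]\<^bsup>2\<^esup>)" using V by (simp add: finite_imp_finite_nsets)
    have "N \<le> v ^ 2" unfolding N_def card_nsets v_def[symmetric]
      by (cases "2 \<le> v") (simp_all add: binomial_le_pow binomial_eq_0)
    then have N: "real N \<le> real v ^ 2" by (metis of_nat_le_iff of_nat_power)
    have L: "0 < ln (real n)" using n by simp
    have rhs: "(real n powr a) ^ card V = exp (a * ln n * v)"
      using n by (simp add: powr_def v_def exp_of_nat_mult[symmetric] mult_ac)
    show "(\<Sum>S\<in>{S \<in> Pow ([V]\<^bsup>2\<^esup>). card S \<le> log_degree n}. X ^ card S) \<le> (real n powr a) ^ card V"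
    proof (cases "real v \<le> c * ln n")
      case True
      have "(\<Sum>S\<in>{S \<in> Pow ([V]\<^bsup>2\<^esup>). card S \<le> log_degree n}. X ^ card S) \<le> (1 + X) ^ N"
        using sum_small_subsets_le[OF fin, of X 1] X by (simp add: N_def)
      also have "\<dots> = exp (ln (1 + X) * N)"
        using X by (simp add: exp_of_nat2_mult)
      also have "\<dots> \<le> exp (a * ln n * v)"
      proof (simp only: exp_le_cancel_iff)
        have "ln (1 + X) * N \<le> ln (1 + X) * (real v * real v)"
          using N lnX by (simp add: power2_eq_square)
        also have "\<dots> \<le> ln (1 + X) * (c * ln n * v)"
          using True lnX by (intro mult_left_mono mult_right_mono) auto
        also have "\<dots> = a * ln n * v" by (simp add: c(2)[symmetric])
        finally show "ln (1 + X) * N \<le> a * ln n * v" .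
      qed
      finally show ?thesis by (simp add: rhs)
    next
      case False
      have "0 < ln (real n) powr (3/2)" using L by simp
      then have "0 < real D" using log_degree_bounds(1)[of n] unfolding D_def by linarith
      then have D: "1 \<le> real D" by simp
      \<comment> \<open>There are at most \<open>v\<^sup>2 \<le> 4 D\<^sup>2\<close> possible edges,
        so this \<open>y\<close> makes \<open>N * (X / y)\<close> at most 1, while
        \<open>ln y\<close> stays of order \<open>ln D\<close>.\<close>
      define y where "y = 4 * X * (real D)\<^sup>2"
      have D2: "1 \<le> (real D)\<^sup>2" using D by simp
      have y: "1 \<le> y" using mult_mono[OF X D2] X D2 unfolding y_def by simp
      have "(\<Sum>S\<in>{S \<in> Pow ([V]\<^bsup>2\<^esup>). card S \<le> log_degree n}. X ^ card S) \<le> y ^ D * (1 + X / y) ^ N"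
        using sum_small_subsets_le[OF fin, of X y] X y by (simp add: N_def D_def)
      also have "\<dots> \<le> y ^ D * exp (X / y) ^ N"
        using X y by (intro mult_left_mono power_mono) (auto intro: exp_ge_add_one_self)
      also have "\<dots> = exp (D * ln y + N * (X / y))"
        using y by (simp add: exp_add exp_of_nat_mult del: times_divide_eq_right)
      also have "\<dots> \<le> exp (a * ln n * v)"
      proof (simp only: exp_le_cancel_iff)
        have "real v \<le> 2 * real D" using V(2) unfolding v_def D_def by linarith
        then have "(real v)\<^sup>2 \<le> (2 * real D)\<^sup>2" by (intro power_mono) auto
        from order_trans[OF N this] have "real N \<le> 4 * (real D)\<^sup>2" by (simp only: power_mult_distrib) simp
        then have "N * (X / y) \<le> 4 * (real D)\<^sup>2 * (X / y)"
          using X y by (intro mult_right_mono) auto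
        also have "\<dots> = 1" using X D by (simp add: y_def)
        finally have "N * (X / y) \<le> 1" .
        moreover have "D * ln y \<le> (ln n powr (3/2) + 1) * ln (4 * X * (ln n powr (3/2) + 1)\<^sup>2)"
          using log_degree_bounds(2)[of n] D y X unfolding y_def D_def[symmetric]
          by (intro mult_mono ln_mono mult_left_mono power_mono) auto
        ultimately have "D * ln y + N * (X / y) \<le> a * c * (ln n)\<^sup>2" using ev by linarith
        also have "\<dots> = a * ln n * (c * ln n)" by (simp add: power2_eq_square)
        \<comment> \<open>This is where the case assumption \<open>v > c ln n\<close>
          enters.\<close>
        also have "\<dots> \<le> a * ln n * v" using False a L by (intro mult_left_mono) auto
        finally show "D * ln y + N * (X / y) \<le> a * ln n * v" .
      qed
      finally show ?thesis by (simp add: rhs)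
    qed
  qed
qed

text \<open>Each of the \<open>v\<close> factors of \<open>n! / (n - v)!\<close> is at least
  \<open>n / 2\<close>. For \<open>n = 0\<close> the hypothesis forces \<open>v = 0\<close>.\<close>

lemma fact_diff_le:
  assumes "2 * v \<le> n"
  shows "fact (n - v) / fact n \<le> (2 / real n) ^ v"
proof -
  have "fact (n - v) * (real n / 2) ^ v \<le> fact n"
    using assms
  proof (induction v)
    case (Suc v)
    have "fact (n - v) = real (n - v) * fact (n - Suc v)"
      using Suc.prems fact_reduce[of "n - v", where 'a = real] by simp
    moreover have "real n / 2 \<le> real (n - v)" using Suc.prems by (simp add: of_nat_diff field_simps)
    ultimately have "fact (n - Suc v) * (real n / 2) \<le> fact (n - v)" by (simp add: mult.commute mult_left_mono)
    then have "fact (n - Suc v) * (real n / 2) * (real n / 2) ^ v \<le> fact (n - v) * (real n / 2) ^ v"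
      by (rule mult_right_mono) simp
    also have "\<dots> \<le> fact n" using Suc by simp
    finally show ?case by (simp only: power_Suc mult.assoc)
  qed simp
  then show ?thesis
    by (cases "n = 0") (use assms in \<open>simp_all add: field_simps power_divide\<close>)
qed

lemma card_Union_edges_le:
  assumes "finite S" "S \<subseteq> [A]\<^bsup>2\<^esup>"
  shows "card (\<Union>S) \<le> 2 * card S"
proof -
  have "card (\<Union>S) \<le> (\<Sum>e\<in>S. card e)" by (rule card_Union_le_sum_card)
  also have "\<dots> = (\<Sum>e\<in>S. 2)" using assms(2) by (intro sum.cong) (auto simp: nsets_def)
  finally show ?thesis by simp
qed

text \<open>Group the edge sets by the vertex set \<open>V\<close> they cover. Each \<open>V\<close>
  contributes at most \<open>(b * m) ^ card V\<close>, and summing over all subsets of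
  \<open>{1..n}\<close> is the binomial theorem. Sets \<open>V\<close> with more than
  \<open>2 * D\<close> vertices are covered by no admissible edge set.\<close>

lemma sum_small_edge_sets_le:
  fixes X b m :: real
  assumes "0 \<le> X" "0 \<le> b" "0 \<le> m"
    and growth: "\<And>V :: nat set. finite V \<Longrightarrow> card V \<le> 2 * D \<Longrightarrow>
      (\<Sum>S\<in>{S \<in> Pow ([V]\<^bsup>2\<^esup>). card S \<le> D}. X ^ card S) \<le> m ^ card V"
  shows "(\<Sum>S\<in>small_edge_sets n D. X ^ card S * b ^ card (\<Union>S)) \<le> (1 + b * m) ^ n"
proof -
  define F where "F = small_edge_sets n D"
  have F: "finite S" "S \<subseteq> [{1..n}]\<^bsup>2\<^esup>" "card S \<le> D" if "S \<in> F" for S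
    using that finite_K[of n] by (auto simp: F_def small_edge_sets_def complete_ugraph_def dest: finite_subset)
  have "(\<Sum>S\<in>F. X ^ card S * b ^ card (\<Union>S))
      = (\<Sum>V\<in>Pow {1..n}. \<Sum>S\<in>{S \<in> F. \<Union>S = V}. X ^ card S * b ^ card (\<Union>S))"
  proof (rule sum.group[symmetric])
    show "Union ` F \<subseteq> Pow {1..n}" using F(2) by (fastforce simp: nsets_def)
  qed (auto simp: F_def finite_small_edge_sets)
  also have "\<dots> \<le> (\<Sum>V\<in>Pow {1..n}. (b * m) ^ card V)"
  proof (rule sum_mono)
    fix V :: "nat set" assume V: "V \<in> Pow {1..n}"
    then have fV: "finite V" using finite_subset by blast
    show "(\<Sum>S\<in>{S \<in> F. \<Union>S = V}. X ^ card S * b ^ card (\<Union>S)) \<le> (b * m) ^ card V"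
    proof (cases "card V \<le> 2 * D")
      case True
      have "(\<Sum>S\<in>{S \<in> F. \<Union>S = V}. X ^ card S * b ^ card (\<Union>S))
          = b ^ card V * (\<Sum>S\<in>{S \<in> F. \<Union>S = V}. X ^ card S)"
        by (simp add: sum_distrib_left mult.commute)
      also have "\<dots> \<le> b ^ card V * (\<Sum>S\<in>{S \<in> Pow ([V]\<^bsup>2\<^esup>). card S \<le> D}. X ^ card S)"
      proof (intro mult_left_mono sum_mono2)
        show "{S \<in> F. \<Union>S = V} \<subseteq> {S \<in> Pow ([V]\<^bsup>2\<^esup>). card S \<le> D}"
          using F(2,3) by (fastforce simp: nsets_def)
        show "finite {S \<in> Pow ([V]\<^bsup>2\<^esup>). card S \<le> D}"
          using fV by (simp add: finite_imp_finite_nsets)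
      qed (use assms in auto)
      also have "\<dots> \<le> b ^ card V * m ^ card V"
        using growth[OF fV True] assms(2) by (intro mult_left_mono) auto
      finally show ?thesis by (simp add: power_mult_distrib)
    next
      case False
      have "\<Union>S \<noteq> V" if "S \<in> F" for S
        using card_Union_edges_le[OF F(1,2)[OF that]] F(3)[OF that] False by auto
      then have empty: "{S \<in> F. \<Union>S = V} = {}" by blast
      show ?thesis unfolding empty using assms by simp
    qed
  qed
  also have "\<dots> = (1 + b * m) ^ n" by (simp add: sum_Pow_power_card)
  finally show ?thesis by (simp add: F_def)
qed

lemma sum_squared_coefficients_le:
  fixes \<epsilon> X :: real
  assumes \<Gamma>: "simple_graph \<Gamma>" "card (verts \<Gamma>) \<le> n"
    and q: "0 < q" "q < 1" and p: "0 \<le> p" "p \<le> 1"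
    and X: "chi_square p q \<le> X" and \<epsilon>: "0 < \<epsilon>" and n: "1 \<le> n" "4 * D \<le> n"
    and bound: "real (max (card (edges \<Gamma>)) ((max_degree \<Gamma>)\<^sup>2)) \<le> real n powr (1 - \<epsilon>)"
    and growth: "\<And>V :: nat set. finite V \<Longrightarrow> card V \<le> 2 * D \<Longrightarrow>
      (\<Sum>S\<in>{S \<in> Pow ([V]\<^bsup>2\<^esup>). card S \<le> D}. X ^ card S) \<le> (real n powr (\<epsilon> / 2)) ^ card V"
  shows "(\<Sum>S\<in>small_edge_sets n D. (measure_pmf.expectation (planted_graph \<Gamma> n p q) (chi q S))\<^sup>2) \<le> exp 8"
proof -
  define M where "M = real n powr (1 - \<epsilon>)"
  \<comment> \<open>This choice meets both requirements of \<open>prob_copy_contains_le\<close>: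
    \<open>R\<^sup>2 = 2 * M\<close> dominates twice the number of edges, and \<open>R\<close>
    dominates the maximum degree.\<close>
  define R where "R = sqrt (2 * M)"
  \<comment> \<open>The square of \<open>R * (2 / n)\<close>, the factor that each covered vertex
    contributes to the containment probability.\<close>
  define b where "b = 2 * M * (2 / real n)\<^sup>2"
  have M: "0 \<le> M" by (simp add: M_def)
  have b: "0 \<le> b" using M by (simp add: b_def)
  have X0: "0 \<le> X" using X q by (auto simp: chi_square_def intro: order_trans[rotated])
  have R: "0 \<le> R" "R\<^sup>2 = 2 * M" using M by (auto simp: R_def)
  have "real (card (edges \<Gamma>)) \<le> M" and d: "(real (max_degree \<Gamma>))\<^sup>2 \<le> M"
    using bound unfolding M_def of_nat_max of_nat_power by simp_all
  then have edg: "2 * real (card (edges \<Gamma>)) \<le> R\<^sup>2" unfolding R by simp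
  have deg: "real (max_degree \<Gamma>) \<le> R"
    unfolding R_def using d M by (intro real_le_rsqrt) simp
  have "(\<Sum>S\<in>small_edge_sets n D. (measure_pmf.expectation (planted_graph \<Gamma> n p q) (chi q S))\<^sup>2)
      \<le> (\<Sum>S\<in>small_edge_sets n D. X ^ card S * b ^ card (\<Union>S))"
  proof (rule sum_mono)
    fix S assume "S \<in> small_edge_sets n D"
    then have S: "S \<subseteq> K n" "card S \<le> D" by (auto simp: small_edge_sets_def)
    define v where "v = card (\<Union>S)"
    define l where "l = (p - q) / sqrt (q * (1 - q))"
    define P where "P = measure_pmf.prob (pmf_of_set (copies n \<Gamma>)) {H. S \<subseteq> edges H}"
    \<comment> \<open>Hence \<open>v \<le> 2 * D\<close>, and \<open>4 * D \<le> n\<close> then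
      gives the condition \<open>2 * v \<le> n\<close> of \<open>fact_diff_le\<close>.\<close>
    have "v \<le> 2 * card S"
      unfolding v_def using S(1) finite_K
      by (intro card_Union_edges_le[of _ "{1..n}"]) (auto simp: complete_ugraph_def dest: finite_subset)
    then have v: "2 * v \<le> n" using S(2) n by linarith
    have "P \<le> R ^ v * (fact (n - v) / fact n)"
      using prob_copy_contains_le[OF \<Gamma> deg edg S(1)] by (simp add: P_def v_def)
    also have "\<dots> \<le> R ^ v * (2 / real n) ^ v"
      using R(1) fact_diff_le[OF v] by (intro mult_left_mono) auto
    finally have "P \<le> (R * (2 / real n)) ^ v" by (simp only: power_mult_distrib)
    then have "P\<^sup>2 \<le> ((R * (2 / real n)) ^ v)\<^sup>2"
      by (intro power_mono) (auto simp: P_def)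
    also have "\<dots> = b ^ v"
      unfolding b_def R(2)[symmetric] by (simp only: power_mult_distrib[symmetric] power_commutes power_mult[symmetric] mult.commute)
    finally have P2: "P\<^sup>2 \<le> b ^ v" .
    have "l\<^sup>2 = chi_square p q" using q by (simp add: l_def chi_square_def power_divide)
    then have l: "(l ^ card S)\<^sup>2 \<le> X ^ card S"
      using X by (metis power_mono power_mult mult.commute zero_le_power2)
    have "(measure_pmf.expectation (planted_graph \<Gamma> n p q) (chi q S))\<^sup>2 = (l ^ card S)\<^sup>2 * P\<^sup>2"
      unfolding expectation_planted_chi[OF \<Gamma> q p S(1)] by (simp add: l_def P_def power_mult_distrib)
    also have "\<dots> \<le> X ^ card S * b ^ v"
      using l P2 X0 by (intro mult_mono) auto
    finally show "(measure_pmf.expectation (planted_graph \<Gamma> n p q) (chi q S))\<^sup>2 \<le> X ^ card S * b ^ card (\<Union>S)"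
      by (simp add: v_def)
  qed
  also have "\<dots> \<le> (1 + b * real n powr (\<epsilon> / 2)) ^ n"
    using X0 b growth by (intro sum_small_edge_sets_le) auto
  also have "\<dots> \<le> exp (b * real n powr (\<epsilon> / 2)) ^ n"
    using b by (intro power_mono exp_ge_add_one_self) auto
  \<comment> \<open>The powers of \<open>n\<close> combine to
    \<open>n * n powr (-1 - \<epsilon>) * n powr (\<epsilon> / 2)\<close>, and 8 is the constant in
    \<open>b\<close>.\<close>
  also have "\<dots> = exp (8 * real n powr (- \<epsilon> / 2))"
  proof -
    have "real n * (b * real n powr (\<epsilon> / 2)) = 8 * (M * real n powr (\<epsilon> / 2) / real n)"
      using n by (simp add: b_def power2_eq_square field_simps)
    also have "M * real n powr (\<epsilon> / 2) / real n = real n powr (1 - \<epsilon> + \<epsilon> / 2 - 1)"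
      unfolding M_def powr_add powr_diff using n by simp
    also have "1 - \<epsilon> + \<epsilon> / 2 - 1 = - \<epsilon> / 2" by simp
    finally show ?thesis by (simp add: exp_of_nat_mult[symmetric])
  qed
  also have "\<dots> \<le> exp 8"
    using n \<epsilon> powr_mono[of "- \<epsilon> / 2" 0 "real n"] by simp
  finally show ?thesis .
qed

section \<open>Application of the conjecture to the planted pair\<close>

theorem theorem2:
  fixes \<Gamma> :: "nat \<Rightarrow> 'a ugraph" and p q :: "nat \<Rightarrow> real" and \<epsilon> :: real
  assumes "\<And>n. simple_graph (\<Gamma> n)"
    and "\<And>n. no_isolated_vertices (\<Gamma> n)"
    and "\<And>n. card (verts (\<Gamma> n)) \<le> n"
    and "\<And>n. 0 < q n \<and> q n < 1"
    and "\<And>n. q n < p n \<and> p n \<le> 1"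
    and "(\<lambda>n. chi_square (p n) (q n)) \<in> \<Theta>(\<lambda>_. 1)"
    and "(\<lambda>n. max_density (\<Gamma> n)) \<in> \<Omega>(\<lambda>n. ln (real (card (verts (\<Gamma> n)))))"
    and "low_degree_conjecture (\<lambda>n. erdos_renyi n (q n)) (\<lambda>n. planted_graph (\<Gamma> n) n (p n) (q n))"
    and "\<epsilon> > 0"
    and "eventually (\<lambda>n. real (max (card (edges (\<Gamma> n))) ((max_degree (\<Gamma> n))\<^sup>2))
           \<le> real n powr (1 - \<epsilon>)) sequentially"
  shows "\<not> (\<exists>\<phi>. polytime_test \<phi> \<and>
           strong_detection (\<lambda>n. erdos_renyi n (q n)) (\<lambda>n. planted_graph (\<Gamma> n) n (p n) (q n)) \<phi>)"
proof -
  let ?P0 = "\<lambda>n. erdos_renyi n (q n)"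
  let ?P1 = "\<lambda>n. planted_graph (\<Gamma> n) n (p n) (q n)"
  have q: "0 < q n" "q n < 1" and p: "0 \<le> p n" "p n \<le> 1" for n
    using assms(4)[of n] assms(5)[of n] by auto
  have supp: "set_pmf (?P1 n) \<subseteq> Pow (K n)" for n
    using set_independent_edges_subset by (auto simp: planted_graph_def)
  obtain c where c: "\<forall>\<^sub>F n in sequentially. norm (chi_square (p n) (q n)) \<le> c * norm (1 :: real)"
    using bigthetaD1[OF assms(6)] by (elim landau_o.bigE)
  \<comment> \<open>An eventual upper bound for \<open>chi_square\<close>, raised to at least 1 as
    \<open>eventually_sum_small_graphs_le\<close> requires.\<close>
  define X where "X = max 1 c"
  have "\<forall>\<^sub>F n :: nat in sequentially. 4 * (ln n powr (3/2) + 1) \<le> n" by real_asymp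
  then have D: "\<forall>\<^sub>F n in sequentially. 4 * log_degree n \<le> n"
  proof eventually_elim
    case (elim n)
    then have "real (4 * log_degree n) \<le> real n" using log_degree_bounds(2)[of n] by simp
    then show ?case by (simp only: of_nat_le_iff)
  qed
  have growth: "\<forall>\<^sub>F n in sequentially. \<forall>V :: nat set. finite V \<longrightarrow> card V \<le> 2 * log_degree n \<longrightarrow>
      (\<Sum>S\<in>{S \<in> Pow ([V]\<^bsup>2\<^esup>). card S \<le> log_degree n}. X ^ card S) \<le> (real n powr (\<epsilon> / 2)) ^ card V"
    by (rule eventually_sum_small_graphs_le) (use assms(9) in \<open>auto simp: X_def\<close>)
  have "\<forall>\<^sub>F n in sequentially. norm (norm_pmf (?P0 n) (low_degree_likelihood_ratio n (?P0 n) (?P1 n) (log_degree n))) \<le> sqrt (exp 8)"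
    using c D assms(10) eventually_ge_at_top[of 1] growth
  proof eventually_elim
    case (elim n)
    have "(norm_pmf (?P0 n) (low_degree_likelihood_ratio n (?P0 n) (?P1 n) (log_degree n)))\<^sup>2 \<le> exp 8"
      unfolding norm_low_degree_likelihood_ratio[OF q supp]
      by (rule sum_squared_coefficients_le[where X = X and \<epsilon> = \<epsilon>])
        (use elim assms(1,3,9) q p in \<open>auto simp: X_def\<close>)
    then show ?case by (simp add: real_le_rsqrt abs_le_iff)
  qed
  \<comment> \<open>An eventual bound suffices here, since the finitely many remaining norms are
    real numbers.\<close>
  then have "Bseq (\<lambda>n. norm_pmf (?P0 n) (low_degree_likelihood_ratio n (?P0 n) (?P1 n) (log_degree n)))"
    by (rule BfunI)
  \<comment> \<open>The exponent parameter of the conjecture is instantiated with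
    \<open>1/2\<close>, independently of the \<open>\<epsilon>\<close> of the theorem.\<close>
  moreover have "ln (real n) powr (1 + 1/2) \<le> real (log_degree n)" for n
    using log_degree_bounds(1)[of n] by simp
  moreover have "absolutely_continuous (measure_pmf (?P0 n)) (measure_pmf (?P1 n))" for n
    using supp by (intro absolutely_continuous_pmf) (simp add: set_erdos_renyi[OF q])
  ultimately show ?thesis
    using assms(8) unfolding low_degree_conjecture_def
    by (meson half_gt_zero zero_less_one)
qed

end
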